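(* Let $\Delta$ be a simplicial complex on the vertex set $V=\{x_1,\dots,x_n\}$ and $\chi$ a colouring of $\Delta$. The following are equivalent: (1) $\Delta_\chi$ is a pseudomanifold; (2) $\chi$ is the $n$-colouring $V=\{x_1\}\cup\cdots\cup\{x_n\}$; (3) $\Delta_\chi$ is the independence complex of a whiskered complex; (4) $\Delta_\chi$ is the independence complex of a grafted complex; (5) $\Delta_\chi$ is a simplicial sphere if $\Delta$ is a simplex, and a simplicial ball otherwise.
   Context: An $s$-colouring (colouring) $\chi$ of $\Delta$ is a partition $V=V_1\cup\cdots\cup V_s$, where some $V_i$ may be empty, with $|V_i\cap F|\le 1$ for every $i$ and every facet $F$. $\Delta_\chi$ is the complex on $V\cup\{y_1,\dots,y_s\}$ with facets $F\cup Y_F$ for $F\in\Delta$, where $Y_F=\{y_j:F\cap V_j=\emptyset\}$ (its faces are the $F\cup G$ with $F\in\Delta$, $G\subseteq Y_F$). A pure $d$-dimensional complex is a pseudomanifold if every $(d-1)$-dimensional face is contained in at most two facets and it is strongly connected (any two facets are joined by a sequence of facets with consecutive ones meeting in a $(d-1)$-face). $\operatorname{Ind}(\Gamma)$ is the complex of vertex subsets containing no facet of $\Gamma$. A leaf of a complex is a facet $F$ which is the only facet or for which some other facet $G$ (a joint) satisfies $F\cap H\subseteq G$ for all facets $H\ne F$. A complex $\Gamma$ is grafted if $\Gamma=\langle F_1,\dots,F_r\rangle\cup\langle G_1,\dots,G_s\rangle$ with: (1) every vertex of $\langle G_1,\dots,G_s\rangle$ lies in some $F_i$; (2) $F_1,\dots,F_r$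 are all the leaves of $\Gamma$; (3) no $G_j$ equals any $F_i$; (4) the $F_i$ are pairwise disjoint; (5) if $G_i$ is a joint, then $\Gamma$ with facet $G_i$ removed is grafted. It is whiskered if moreover the leaves $F_1,\dots,F_r$ are all edges (1-dimensional). Simplicial sphere/ball: geometric realization homeomorphic to a sphere/ball.
   Formalization: Colourings consisting of all the singletons {x_i} together with one or more additional empty classes are excluded (the equivalence fails for them, e.g. V={x}, V_1={x}, V_2 empty); V is taken non-empty. *)

theory Defs
  imports "HOL-Homology.Homology"
begin

section \<open>Abstract simplicial complexes\<close>

text \<open>A complex is represented by its set of faces, the empty face included. Every element of
  the vertex set is a face, so there are no ghost vertices.\<close>

definition complex_on :: "'v set \<Rightarrow> 'v set set \<Rightarrow> bool" where
  "complex_on V \<Delta> \<longleftrightarrow>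
     finite V \<and> \<Delta> \<subseteq> Pow V \<and> (\<forall>v\<in>V. {v} \<in> \<Delta>) \<and> (\<forall>F\<in>\<Delta>. \<forall>G. G \<subseteq> F \<longrightarrow> G \<in> \<Delta>)"

definition facets :: "'v set set \<Rightarrow> 'v set set" where
  "facets \<Delta> = {F \<in> \<Delta>. \<forall>G\<in>\<Delta>. F \<subseteq> G \<longrightarrow> G = F}"

definition generated :: "'v set set \<Rightarrow> 'v set set" where
  "generated S = {G. \<exists>F\<in>S. G \<subseteq> F}"

definition dimension :: "'v set \<Rightarrow> int" where
  "dimension F = int (card F) - 1"

definition is_simplex :: "'v set set \<Rightarrow> bool" where
  "is_simplex \<Delta> \<longleftrightarrow> (\<exists>F. facets \<Delta> = {F})"

definition pure :: "int \<Rightarrow> 'v set set \<Rightarrow> bool" where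
  "pure d \<Delta> \<longleftrightarrow> (\<forall>F\<in>facets \<Delta>. dimension F = d)"

definition strongly_connected :: "int \<Rightarrow> 'v set set \<Rightarrow> bool" where
  "strongly_connected d \<Delta> \<longleftrightarrow> (\<forall>F\<in>facets \<Delta>. \<forall>G\<in>facets \<Delta>.
     (F, G) \<in> {(A, B). A \<in> facets \<Delta> \<and> B \<in> facets \<Delta> \<and> dimension (A \<inter> B) = d - 1}\<^sup>*)"

definition pseudomanifold :: "'v set set \<Rightarrow> bool" where
  "pseudomanifold \<Delta> \<longleftrightarrow> (\<exists>d. pure d \<Delta> \<and>
     (\<forall>R\<in>\<Delta>. dimension R = d - 1 \<longrightarrow> card {F \<in> facets \<Delta>. R \<subseteq> F} \<le> 2) \<and>
     strongly_connected d \<Delta>)"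

text \<open>The vertices of \<open>\<Gamma>\<close> are the elements of \<open>\<Union>\<Gamma>\<close>.\<close>

definition Ind :: "'v set set \<Rightarrow> 'v set set" where
  "Ind \<Gamma> = {W. W \<subseteq> \<Union>\<Gamma> \<and> \<not> (\<exists>F\<in>facets \<Gamma>. F \<subseteq> W)}"


section \<open>Colourings\<close>

text \<open>The colour classes are \<open>c 1, \<dots>, c s\<close>; the values of \<open>c\<close> outside \<open>{1..s}\<close> are irrelevant.
  Classes may be empty.\<close>

definition colouring :: "'a set \<Rightarrow> 'a set set \<Rightarrow> nat \<Rightarrow> (nat \<Rightarrow> 'a set) \<Rightarrow> bool" where
  "colouring V \<Delta> s c \<longleftrightarrow>
     (\<Union>i\<in>{1..s}. c i) = V \<and> disjoint_family_on c {1..s} \<and>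
     (\<forall>i\<in>{1..s}. \<forall>F\<in>facets \<Delta>. card (c i \<inter> F) \<le> 1)"

text \<open>The partition into singletons, up to the numbering of the classes.\<close>

definition discrete_colouring :: "'a set \<Rightarrow> nat \<Rightarrow> (nat \<Rightarrow> 'a set) \<Rightarrow> bool" where
  "discrete_colouring V s c \<longleftrightarrow> s = card V \<and> c ` {1..s} = (\<lambda>x. {x}) ` V"

definition missed_colours :: "nat \<Rightarrow> (nat \<Rightarrow> 'a set) \<Rightarrow> 'a set \<Rightarrow> nat set" where
  "missed_colours s c F = {j \<in> {1..s}. F \<inter> c j = {}}"

text \<open>In \<open>\<Delta>\<^sub>c\<close>, the vertex \<open>x\<close> of \<open>\<Delta>\<close> is \<open>Inl x\<close> and the new vertex \<open>y\<^sub>j\<close> is \<open>Inr j\<close>.\<close>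

definition colour_complex ::
    "'a set set \<Rightarrow> nat \<Rightarrow> (nat \<Rightarrow> 'a set) \<Rightarrow> ('a + nat) set set" where
  "colour_complex \<Delta> s c =
     {Inl ` F \<union> Inr ` J | F J. F \<in> \<Delta> \<and> J \<subseteq> missed_colours s c F}"

text \<open>If all classes have at most one element and some are empty, i.e. if the partition into
  singletons is padded by empty classes, then \<open>\<Delta>\<^sub>c\<close> is an iterated cone over the complex of the
  partition into singletons. It is then still a pseudomanifold, and a ball even if \<open>\<Delta>\<close> is a
  simplex; for instance, if \<open>\<Delta>\<close> is a single vertex and there is one additional empty class,
  \<open>\<Delta>\<^sub>c\<close> is a path with two edges, which is neither a sphere nor an independence complex
  of a grafted complex. The equivalences fail for these colourings.\<close>

definition padded_discrete_colouring :: "'a set \<Rightarrow> nat \<Rightarrow> (nat \<Rightarrow> 'a set) \<Rightarrow> bool" where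
  "padded_discrete_colouring V s c \<longleftrightarrow>
     (\<forall>i\<in>{1..s}. card (c i) \<le> 1) \<and> (\<exists>i\<in>{1..s}. c i = {})"


section \<open>Grafted and whiskered complexes\<close>

definition joint_of :: "'v set set \<Rightarrow> 'v set \<Rightarrow> 'v set \<Rightarrow> bool" where
  "joint_of \<Gamma> F G \<longleftrightarrow> F \<in> facets \<Gamma> \<and> G \<in> facets \<Gamma> \<and> G \<noteq> F \<and>
     (\<forall>H\<in>facets \<Gamma>. H \<noteq> F \<longrightarrow> F \<inter> H \<subseteq> G)"

definition leaf :: "'v set set \<Rightarrow> 'v set \<Rightarrow> bool" where
  "leaf \<Gamma> F \<longleftrightarrow> F \<in> facets \<Gamma> \<and> (facets \<Gamma> = {F} \<or> (\<exists>G. joint_of \<Gamma> F G))"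

inductive grafted :: "'v set set \<Rightarrow> bool" where
  "grafted \<Gamma>"
  if "complex_on (\<Union>\<Gamma>) \<Gamma>"
    and "facets \<Gamma> = \<F> \<union> \<G>"
    and "\<Union>\<G> \<subseteq> \<Union>\<F>"
    and "\<F> = {F. leaf \<Gamma> F}"
    and "\<F> \<inter> \<G> = {}"
    and "pairwise disjnt \<F>"
    and "\<And>G. G \<in> \<G> \<Longrightarrow> (\<exists>F. joint_of \<Gamma> F G) \<Longrightarrow> grafted (generated (facets \<Gamma> - {G}))"

definition whiskered :: "'v set set \<Rightarrow> bool" where
  "whiskered \<Gamma> \<longleftrightarrow> grafted \<Gamma> \<and> (\<forall>F. leaf \<Gamma> F \<longrightarrow> dimension F = 1)"


section \<open>Simplicial spheres and balls\<close>

text \<open>Points of the realization are given by their barycentric coordinates.\<close>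

definition geometric_realization :: "'v set set \<Rightarrow> ('v \<Rightarrow> real) topology" where
  "geometric_realization \<Delta> = subtopology (powertop_real UNIV)
     {t. (\<forall>v. 0 \<le> t v) \<and> {v. t v \<noteq> 0} \<in> \<Delta> \<and> (\<Sum>v | t v \<noteq> 0. t v) = 1}"

definition nball :: "nat \<Rightarrow> (nat \<Rightarrow> real) topology" where
  "nball d = subtopology (Euclidean_space d) {x. (\<Sum>i<d. x i ^ 2) \<le> 1}"

definition simplicial_sphere :: "'v set set \<Rightarrow> bool" where
  "simplicial_sphere \<Delta> \<longleftrightarrow> (\<exists>d. geometric_realization \<Delta> homeomorphic_space nsphere d)"

definition simplicial_ball :: "'v set set \<Rightarrow> bool" where
  "simplicial_ball \<Delta> \<longleftrightarrow> (\<exists>d. geometric_realization \<Delta> homeomorphic_space nball d)"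

end

theory Submission
  imports Defs
begin

text \<open>If the classes are singletons, the vertices of \<open>\<Delta>\<^sub>c\<close> come in pairs \<open>x\<^sub>i, y\<^sub>i\<close>, and
  \<open>\<Delta>\<^sub>c\<close> is the part of the boundary of the cross-polytope consisting of the faces with positive
  part in \<open>\<Delta>\<close>. It is the independence complex of the minimal nonfaces of \<open>\<Delta>\<close> with a whisker
  \<open>{x\<^sub>i, y\<^sub>i}\<close> attached at every vertex. The cone over it is a closed set of vectors that is
  stable under decreasing coordinates, so unless it is everything, it lies below a graph in
  direction \<open>(1, \<dots>, 1)\<close> and can be straightened to a half-space by a positively homogeneous map.

  If a class \<open>j\<close> contains \<open>a \<noteq> b\<close>, then the \<open>y\<^sub>i\<close> with \<open>i \<noteq> j\<close> span a ridge lying in the three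
  facets that add \<open>y\<^sub>j\<close>, \<open>a\<close> and \<open>b\<close>. Two of these pages contain a full-dimensional open set, which
  would be open in a ball by invariance of domain, but the third page accumulates at it.\<close>

section \<open>The facets of the colour complex\<close>

text \<open>No implication between two of the five conditions is proved directly. Excluding padded
  colourings leaves a dichotomy: either every class is a singleton and all five conditions hold, or
  two vertices share a colour and all five fail. In the second case \<Delta> cannot be a simplex, so
  the last condition asks only for a ball. Both cases rest on one count: a face meets as many
  classes as it has vertices, hence every facet of \<open>\<Delta>\<^sub>c\<close> has exactly
  \<open>s\<close> vertices. The obstacle in refuting the ball is that its dimension is not given.
  Only a homeomorphism with some \<open>nball d\<close> is known, and openness of the image can be
  used only once d has been identified with the dimension of the pages.\<close>

lemma Inl_Inr_vimage: "X = Inl ` {v. Inl v \<in> X} \<union> Inr ` {j. Inr j \<in> X}"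
proof (intro equalityI subsetI)
  fix p assume "p \<in> X"
  then show "p \<in> Inl ` {v. Inl v \<in> X} \<union> Inr ` {j. Inr j \<in> X}" by (cases p) auto
qed auto

lemma colour_complex_iff:
  "X \<in> colour_complex \<Delta> s c \<longleftrightarrow>
     {v. Inl v \<in> X} \<in> \<Delta> \<and> (\<forall>j. Inr j \<in> X \<longrightarrow> j \<in> {1..s} \<and> (\<forall>v\<in>c j. Inl v \<notin> X))"
  (is "?L \<longleftrightarrow> ?R")
proof
  assume ?L
  then obtain F J where FJ: "F \<in> \<Delta>" "J \<subseteq> missed_colours s c F" "X = Inl ` F \<union> Inr ` J"
    by (auto simp: colour_complex_def)
  then have "{v. Inl v \<in> X} = F" by auto
  with FJ show ?R by (auto simp: missed_colours_def)
next
  assume R: ?R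
  then have "{j. Inr j \<in> X} \<subseteq> missed_colours s c {v. Inl v \<in> X}"
    by (auto simp: missed_colours_def)
  with R show ?L
    using Inl_Inr_vimage[of X] unfolding colour_complex_def by blast
qed

text \<open>The argument runs over all faces of \<Delta>, the empty one included, and not only over
  its facets: enlarging a face trades a new vertex \<open>y\<^sub>j\<close> for an old one of colour
  j, so these sets are never properly nested.\<close>

definition facet_over :: "nat \<Rightarrow> (nat \<Rightarrow> 'a set) \<Rightarrow> 'a set \<Rightarrow> ('a + nat) set" where
  "facet_over s c F = Inl ` F \<union> Inr ` missed_colours s c F"

locale coloured_complex =
  fixes V :: "'a set" and \<Delta> :: "'a set set" and s :: nat and c :: "nat \<Rightarrow> 'a set"
  assumes cplx: "complex_on V \<Delta>" and V_ne: "V \<noteq> {}" and col: "colouring V \<Delta> s c"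
begin

lemma finite_V: "finite V" and face_sub: "F \<in> \<Delta> \<Longrightarrow> F \<subseteq> V"
  and vertex: "v \<in> V \<Longrightarrow> {v} \<in> \<Delta>" and down: "F \<in> \<Delta> \<Longrightarrow> G \<subseteq> F \<Longrightarrow> G \<in> \<Delta>"
  using cplx by (auto simp: complex_on_def)

lemma finite_face: "F \<in> \<Delta> \<Longrightarrow> finite F"
  using face_sub finite_V finite_subset by blast

text \<open>With V empty, \<open>complex_on\<close> would also admit a family without any face. The
  empty face matters because it indexes the facet of all \<open>y\<^sub>j\<close>.\<close>

lemma empty_face: "{} \<in> \<Delta>"
  using V_ne vertex down by blast

lemma finite_complex: "finite \<Delta>"
  using face_sub finite_V by (meson Pow_iff finite_Pow_iff finite_subset subsetI)

lemma face_in_facet: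
  assumes "F \<in> \<Delta>"
  obtains G where "G \<in> facets \<Delta>" "F \<subseteq> G"
proof -
  obtain G where "G \<in> \<Delta>" "F \<subseteq> G" "\<forall>H\<in>\<Delta>. G \<subseteq> H \<longrightarrow> G = H"
    using finite_has_maximal2[OF finite_complex assms] by blast
  with that show thesis by (auto simp: facets_def)
qed

text \<open>The colouring condition speaks of facets only; it passes to faces because each face lies
  in a facet.\<close>

lemma class_unique:
  assumes "F \<in> \<Delta>" "v \<in> F" "w \<in> F" "j \<in> {1..s}" "v \<in> c j" "w \<in> c j"
  shows "v = w"
proof -
  obtain G where G: "G \<in> facets \<Delta>" "F \<subseteq> G" using face_in_facet[OF assms(1)] .
  then have "finite (c j \<inter> G)" by (auto simp: facets_def finite_face)
  moreover have "card (c j \<inter> G) \<le> 1" using col G assms(4) by (auto simp: colouring_def)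
  ultimately have "\<forall>v\<in>c j \<inter> G. \<forall>w\<in>c j \<inter> G. v = w"
    using card_le_Suc0_iff_eq by auto
  then show ?thesis using assms G by blast
qed

lemma colour_exists: "v \<in> V \<Longrightarrow> \<exists>j\<in>{1..s}. v \<in> c j"
  using col by (auto simp: colouring_def)

lemma class_sub: "j \<in> {1..s} \<Longrightarrow> c j \<subseteq> V"
  using col by (auto simp: colouring_def)

lemma class_disjoint: "i \<in> {1..s} \<Longrightarrow> j \<in> {1..s} \<Longrightarrow> v \<in> c i \<Longrightarrow> v \<in> c j \<Longrightarrow> i = j"
  using col unfolding colouring_def disjoint_family_on_def by blast

lemma s_pos: "1 \<le> s"
proof -
  obtain v where "v \<in> V" using V_ne by blast
  with colour_exists show ?thesis by fastforce
qed

text \<open>The classes partition V and each meets F in at most one element, so the colours used by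
  F are in bijection with its elements.\<close>

lemma card_missed:
  assumes "F \<in> \<Delta>"
  shows "card F + card (missed_colours s c F) = s"
proof -
  have "F = (\<Union>j\<in>{1..s}. F \<inter> c j)"
    using colour_exists face_sub[OF assms] by blast
  then have "card F = card (\<Union>j\<in>{1..s}. F \<inter> c j)" by simp
  also have "\<dots> = (\<Sum>j\<in>{1..s}. card (F \<inter> c j))"
    using finite_face[OF assms] class_disjoint by (intro card_UN_disjoint) blast+
  also have "\<dots> = (\<Sum>j\<in>{1..s}. if j \<in> missed_colours s c F then 0 else 1)"
  proof (intro sum.cong refl)
    fix j assume j: "j \<in> {1..s}"
    show "card (F \<inter> c j) = (if j \<in> missed_colours s c F then 0 else 1)"
    proof (cases "F \<inter> c j = {}")
      case False
      then obtain v where v: "v \<in> F \<inter> c j" by blast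
      then have "F \<inter> c j = {v}" using class_unique[OF assms _ _ j] by blast
      then show ?thesis using v j by (auto simp: missed_colours_def)
    qed (use j in \<open>auto simp: missed_colours_def\<close>)
  qed
  also have "\<dots> = card ({1..s} - missed_colours s c F)"
    by (subst sum.If_cases) (auto intro!: arg_cong[where f=card])
  also have "\<dots> = s - card (missed_colours s c F)"
    by (subst card_Diff_subset) (auto simp: missed_colours_def)
  finally have "card F = s - card (missed_colours s c F)" .
  moreover have "card (missed_colours s c F) \<le> card {1..s}"
    by (intro card_mono) (auto simp: missed_colours_def)
  ultimately show ?thesis by simp
qed

lemma finite_missed: "finite (missed_colours s c F)"
  by (simp add: missed_colours_def)

lemma card_facet_over: "F \<in> \<Delta> \<Longrightarrow> card (facet_over s c F) = s"
  using card_missed[of F] finite_face[of F] finite_missed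
  by (subst facet_over_def, subst card_Un_disjoint) (auto simp: card_image)

lemma facet_over_face: "F \<in> \<Delta> \<Longrightarrow> facet_over s c F \<in> colour_complex \<Delta> s c"
  by (auto simp: facet_over_def colour_complex_def)

lemma face_sub_facet_over:
  assumes "X \<in> colour_complex \<Delta> s c"
  shows "X \<subseteq> facet_over s c {v. Inl v \<in> X}"
proof
  fix p assume "p \<in> X"
  with assms show "p \<in> facet_over s c {v. Inl v \<in> X}"
    by (cases p) (auto simp: colour_complex_iff facet_over_def missed_colours_def)
qed

text \<open>All sets \<open>facet_over s c F\<close> have the same cardinality, so one contained in
  another equals it, and maximality follows from this count.\<close>

lemma facets_colour_complex: "facets (colour_complex \<Delta> s c) = facet_over s c ` \<Delta>"
proof (intro equalityI subsetI)
  fix X assume X: "X \<in> facets (colour_complex \<Delta> s c)"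
  then have "{v. Inl v \<in> X} \<in> \<Delta>" by (auto simp: facets_def colour_complex_iff)
  with X show "X \<in> facet_over s c ` \<Delta>"
    using face_sub_facet_over[of X] facet_over_face unfolding facets_def by fastforce
next
  fix X assume "X \<in> facet_over s c ` \<Delta>"
  then obtain F where F: "F \<in> \<Delta>" "X = facet_over s c F" by blast
  have "Z = X" if Z: "Z \<in> colour_complex \<Delta> s c" "X \<subseteq> Z" for Z
  proof -
    let ?G = "{v. Inl v \<in> Z}"
    have G: "?G \<in> \<Delta>" using Z by (simp add: colour_complex_iff)
    have sub: "X \<subseteq> facet_over s c ?G" using Z face_sub_facet_over by blast
    have fin: "finite (facet_over s c ?G)" 
      using finite_face[OF G] finite_missed by (simp add: facet_over_def)
    have "X = facet_over s c ?G"
      using card_subset_eq[OF fin sub] F G card_facet_over by simp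
    then show ?thesis using Z face_sub_facet_over by blast
  qed
  then show "X \<in> facets (colour_complex \<Delta> s c)"
    using F facet_over_face by (auto simp: facets_def)
qed

section \<open>Purity, strong connectedness and ridges\<close>

lemma colour_complex_pure: "pure (int s - 1) (colour_complex \<Delta> s c)"
  by (auto simp: pure_def facets_colour_complex dimension_def card_facet_over)

text \<open>Removing one vertex of F gains exactly one missed colour, so the two facets share all
  but one vertex. Iterating leads from every facet to the one over the empty face.\<close>

lemma colour_complex_strongly_connected:
  "strongly_connected (int s - 1) (colour_complex \<Delta> s c)"
proof -
  define r where "r = {(A, B). A \<in> facets (colour_complex \<Delta> s c) \<and>
    B \<in> facets (colour_complex \<Delta> s c) \<and> dimension (A \<inter> B) = int s - 1 - 1}"
  have to_empty: "(facet_over s c F, facet_over s c {}) \<in> r\<^sup>*" if "F \<in> \<Delta>" for F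
    using finite_face[OF that] that
  proof (induction F)
    case (insert v F)
    have F: "F \<in> \<Delta>" using insert.prems down by blast
    have "facet_over s c (insert v F) \<inter> facet_over s c F
        = Inl ` F \<union> Inr ` missed_colours s c (insert v F)"
      by (auto simp: facet_over_def missed_colours_def)
    moreover have "card (Inl ` F \<union> Inr ` missed_colours s c (insert v F)) + 1 = s"
      using card_missed[OF insert.prems] insert.hyps finite_missed
      by (subst card_Un_disjoint) (auto simp: card_image)
    ultimately have "(facet_over s c (insert v F), facet_over s c F) \<in> r"
      using insert.prems F by (auto simp: r_def facets_colour_complex dimension_def)
    with insert.IH[OF F] show ?case by (rule converse_rtrancl_into_rtrancl[rotated])
  qed simp
  have "sym r" unfolding r_def sym_def by (auto simp: Int_commute)
  then have "(facet_over s c F, facet_over s c G) \<in> r\<^sup>*" if "F \<in> \<Delta>" "G \<in> \<Delta>" for F G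
    using to_empty[OF that(1)] to_empty[OF that(2)] by (meson rtrancl_trans symD sym_rtrancl)
  then show ?thesis
    by (auto simp: strongly_connected_def facets_colour_complex r_def)
qed

text \<open>A ridge leaves exactly one colour j that is neither used by its old vertices nor
  represented by its new ones. A vertex completing the ridge must carry this colour, and a singleton
  class offers only two: \<open>y\<^sub>j\<close> and the element of class j.\<close>

lemma card_facets_over_ridge:
  assumes R: "R \<in> colour_complex \<Delta> s c" "card R + 1 = s"
    and classes: "\<And>j. j \<in> {1..s} \<Longrightarrow> \<exists>x. c j = {x}"
  shows "card {X \<in> facets (colour_complex \<Delta> s c). R \<subseteq> X} \<le> 2"
proof -
  define F J where "F = {v. Inl v \<in> R}" and "J = {j. Inr j \<in> R}"
  have F: "F \<in> \<Delta>" and JM: "J \<subseteq> missed_colours s c F"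
    using R by (auto simp: F_def J_def colour_complex_iff missed_colours_def)
  have finJ: "finite J" using JM finite_missed finite_subset by blast
  have Req: "R = Inl ` F \<union> Inr ` J"
    unfolding F_def J_def by (rule Inl_Inr_vimage)
  then have "card R = card F + card J"
    using finite_face[OF F] finJ by (simp only: Req, subst card_Un_disjoint) (auto simp: card_image)
  then have "card (missed_colours s c F - J) = 1"
    using card_missed[OF F] R(2) JM finJ by (subst card_Diff_subset) auto
  then obtain j where j: "missed_colours s c F - J = {j}" by (auto simp: card_1_singleton_iff)
  then have "j \<in> {1..s}" by (auto simp: missed_colours_def)
  then obtain x where x: "c j = {x}" using classes by blast
  have "X = insert (Inl x) R \<or> X = insert (Inr j) R" if X: "X \<in> facets (colour_complex \<Delta> s c)" "R \<subseteq> X" for X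
  proof -
    obtain G where G: "G \<in> \<Delta>" "X = facet_over s c G" using X facets_colour_complex by blast
    have XC: "X \<in> colour_complex \<Delta> s c" using X by (simp add: facets_def)
    have finR: "finite R" using Req finJ finite_face[OF F] by simp
    have "card X = s" using G card_facet_over by simp
    then have "card (X - R) = 1" using R(2) X(2) finR by (subst card_Diff_subset) auto
    then obtain p where "X - R = {p}" by (auto simp: card_1_singleton_iff)
    then have p: "X = insert p R" "p \<notin> R" using X(2) by auto
    show ?thesis
    proof (cases p)
      case (Inr k)
      then have "k \<in> missed_colours s c F - J"
        using XC p by (auto simp: colour_complex_iff missed_colours_def F_def J_def)
      then show ?thesis using j p Inr by auto
    next
      case (Inl v)
      have Ins: "{v. Inl v \<in> X} \<in> \<Delta>" using XC by (simp add: colour_complex_iff)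
      then have "v \<in> V" using face_sub p Inl by blast
      then obtain k where k: "k \<in> {1..s}" "v \<in> c k" using colour_exists by blast
      have "k \<notin> J" using XC p Inl k by (auto simp: colour_complex_iff J_def)
      moreover have "F \<inter> c k = {}"
      proof (rule ccontr)
        assume "F \<inter> c k \<noteq> {}"
        then obtain w where "w \<in> F" "w \<in> c k" by blast
        then have "v = w" using class_unique[OF Ins _ _ k(1)] p Inl k by (auto simp: F_def)
        with \<open>w \<in> F\<close> p Inl show False by (auto simp: F_def)
      qed
      ultimately have "k = j" using j k by (auto simp: missed_colours_def)
      then show ?thesis using x k p Inl by auto
    qed
  qed
  then have "{X \<in> facets (colour_complex \<Delta> s c). R \<subseteq> X} \<subseteq> {insert (Inl x) R, insert (Inr j) R}"
    by blast
  then have "card {X \<in> facets (colour_complex \<Delta> s c). R \<subseteq> X} \<le> card {insert (Inl x) R, insert (Inr j) R}"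
    by (intro card_mono) auto
  also have "\<dots> \<le> 2" by (simp add: card_insert_if)
  finally show ?thesis .
qed

lemma pseudomanifold_if_singletons:
  assumes "\<And>j. j \<in> {1..s} \<Longrightarrow> \<exists>x. c j = {x}"
  shows "pseudomanifold (colour_complex \<Delta> s c)"
  unfolding pseudomanifold_def
proof (intro exI[of _ "int s - 1"] conjI ballI impI)
  fix R assume "R \<in> colour_complex \<Delta> s c" "dimension R = int s - 1 - 1"
  then show "card {F \<in> facets (colour_complex \<Delta> s c). R \<subseteq> F} \<le> 2"
    using assms by (intro card_facets_over_ridge) (auto simp: dimension_def)
qed (use colour_complex_pure colour_complex_strongly_connected in auto)

text \<open>Both facets are displayed over the same ridge of all \<open>y\<^sub>i\<close> with i
  different from j. This form serves the count of facets at a ridge as well as the topological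
  argument.\<close>

lemma facet_over_pages:
  assumes "j \<in> {1..s}" "a \<in> c j"
  shows "facet_over s c {} = insert (Inr j) (Inr ` ({1..s} - {j}))"
    and "facet_over s c {a} = insert (Inl a) (Inr ` ({1..s} - {j}))"
proof -
  have "a \<in> c k \<longleftrightarrow> k = j" if "k \<in> {1..s}" for k
    using class_disjoint[OF assms(1) that assms(2)] assms(2) by blast
  then have "missed_colours s c {a} = {1..s} - {j}"
    unfolding missed_colours_def by blast
  then show "facet_over s c {a} = insert (Inl a) (Inr ` ({1..s} - {j}))"
    by (simp add: facet_over_def)
  show "facet_over s c {} = insert (Inr j) (Inr ` ({1..s} - {j}))"
    using assms by (auto simp: facet_over_def missed_colours_def)
qed

lemma not_pseudomanifold:
  assumes j: "j \<in> {1..s}" and ab: "a \<in> c j" "b \<in> c j" "a \<noteq> b"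
  shows "\<not> pseudomanifold (colour_complex \<Delta> s c)"
proof
  assume "pseudomanifold (colour_complex \<Delta> s c)"
  then obtain d where d: "pure d (colour_complex \<Delta> s c)"
    and two: "\<And>R. R \<in> colour_complex \<Delta> s c \<Longrightarrow> dimension R = d - 1 \<Longrightarrow>
      card {F \<in> facets (colour_complex \<Delta> s c). R \<subseteq> F} \<le> 2"
    unfolding pseudomanifold_def by blast
  \<comment> \<open>The dimension d is existentially quantified; a concrete facet pins it down to s
    - 1.\<close>
  have "facet_over s c {} \<in> facets (colour_complex \<Delta> s c)"
    using empty_face facets_colour_complex by blast
  then have ds: "d = int s - 1"
    using d colour_complex_pure by (auto simp: pure_def)
  let ?R = "Inr ` ({1..s} - {j}) :: ('a + nat) set"
  have "?R \<in> colour_complex \<Delta> s c"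
    using empty_face by (simp add: colour_complex_iff image_iff)
  moreover have "dimension ?R = d - 1"
    using j s_pos ds by (auto simp: dimension_def card_image)
  moreover have abV: "a \<in> V" "b \<in> V" using class_sub[OF j] ab by auto
  ultimately have le: "card {F \<in> facets (colour_complex \<Delta> s c). ?R \<subseteq> F} \<le> 2"
    using two by blast
  let ?T = "{insert (Inr j) ?R, insert (Inl a) ?R, insert (Inl b) ?R}"
  have "insert (Inr j) ?R \<in> facet_over s c ` \<Delta>" "insert (Inl a) ?R \<in> facet_over s c ` \<Delta>"
    "insert (Inl b) ?R \<in> facet_over s c ` \<Delta>"
    using facet_over_pages[OF j ab(1)] facet_over_pages[OF j ab(2)] vertex[OF abV(1)]
      vertex[OF abV(2)] empty_face by (metis imageI)+
  then have sub: "?T \<subseteq> {F \<in> facets (colour_complex \<Delta> s c). ?R \<subseteq> F}"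
    unfolding facets_colour_complex by blast
  have fin: "finite {F \<in> facets (colour_complex \<Delta> s c). ?R \<subseteq> F}"
    by (simp add: facets_colour_complex finite_complex)
  have "Inl a \<in> insert (Inl a) ?R" "Inl a \<notin> insert (Inl b) ?R" "Inl a \<notin> insert (Inr j) ?R"
    "Inl b \<in> insert (Inl b) ?R" "Inl b \<notin> insert (Inr j) ?R"
    using ab(3) by (simp_all add: image_iff)
  then have "insert (Inl a) ?R \<noteq> insert (Inl b) ?R" "insert (Inr j) ?R \<noteq> insert (Inl a) ?R"
    "insert (Inr j) ?R \<noteq> insert (Inl b) ?R"
    by metis+
  then have "card ?T = 3" by simp
  then show False using card_mono[OF fin sub] le by linarith
qed

section \<open>Singleton classes or a repeated colour\<close>

lemma discrete_enumeration:
  assumes "discrete_colouring V s c"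
  obtains x where "bij_betw x {1..s} V" "\<And>j. j \<in> {1..s} \<Longrightarrow> c j = {x j}"
proof -
  have "\<forall>j\<in>{1..s}. \<exists>x. c j = {x}"
  proof
    fix j assume "j \<in> {1..s}"
    then have "c j \<in> (\<lambda>x. {x}) ` V" using assms unfolding discrete_colouring_def by blast
    then show "\<exists>x. c j = {x}" by blast
  qed
  then obtain x where x: "\<And>j. j \<in> {1..s} \<Longrightarrow> c j = {x j}" by metis
  have "inj_on x {1..s}"
  proof (rule inj_onI, rule ccontr)
    fix i j assume "i \<in> {1..s}" "j \<in> {1..s}" "x i = x j" "i \<noteq> j"
    then show False using class_disjoint[of i j "x i"] x by simp
  qed
  moreover have "x ` {1..s} = V" using col x by (auto simp: colouring_def)
  ultimately show thesis using that x by (auto simp: bij_betw_def)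
qed

text \<open>If no class has two elements, an empty class would make the colouring padded, so all
  classes are singletons. This is where the exclusion of padded colourings enters.\<close>

lemma discrete_or_large_class:
  assumes "\<not> padded_discrete_colouring V s c"
  obtains "discrete_colouring V s c"
  | j a b where "j \<in> {1..s}" "a \<in> c j" "b \<in> c j" "a \<noteq> b"
proof (cases "\<forall>j\<in>{1..s}. card (c j) \<le> 1")
  case True
  have "\<forall>j\<in>{1..s}. \<exists>x. c j = {x}"
  proof
    fix j assume j: "j \<in> {1..s}"
    then have "c j \<noteq> {}" "card (c j) \<le> 1"
      using True assms by (auto simp: padded_discrete_colouring_def)
    moreover have "finite (c j)" using class_sub[OF j] finite_V finite_subset by blast
    ultimately have "card (c j) = 1" by (simp add: card_gt_0_iff le_antisym Suc_le_eq)
    then show "\<exists>x. c j = {x}" by (auto simp: card_1_singleton_iff)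
  qed
  then obtain x where x: "\<And>j. j \<in> {1..s} \<Longrightarrow> c j = {x j}" by metis
  have inj: "inj_on x {1..s}"
  proof (rule inj_onI, rule ccontr)
    fix i j assume "i \<in> {1..s}" "j \<in> {1..s}" "x i = x j" "i \<noteq> j"
    then show False using class_disjoint[of i j "x i"] x by simp
  qed
  have im: "x ` {1..s} = V" using col x by (auto simp: colouring_def)
  have "s = card V" using card_image[OF inj] im by simp
  moreover have "c ` {1..s} = (\<lambda>x. {x}) ` V" 
    unfolding im[symmetric] image_image using x by (intro image_cong) auto
  ultimately show thesis using that(1) by (simp add: discrete_colouring_def)
next
  case False
  then obtain j where j: "j \<in> {1..s}" "\<not> card (c j) \<le> 1" by blast
  have "finite (c j)" using class_sub[OF j(1)] finite_V finite_subset by blast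
  then show thesis using j that(2)
    by (metis One_nat_def card_le_Suc0_iff_eq)
qed

end

section \<open>Whiskered and grafted complexes\<close>

lemma facets_generated:
  assumes "\<And>F G. F \<in> S \<Longrightarrow> G \<in> S \<Longrightarrow> F \<subseteq> G \<Longrightarrow> F = G"
  shows "facets (generated S) = S"
  using assms unfolding facets_def generated_def by blast

lemma Union_generated: "\<Union>(generated T) = \<Union>T"
  unfolding generated_def by blast

lemma complex_on_generated:
  assumes "finite (\<Union>T)"
  shows "complex_on (\<Union>(generated T)) (generated T)"
  unfolding complex_on_def
proof (intro conjI ballI allI impI)
  show "finite (\<Union>(generated T))" using assms by (simp add: Union_generated)
  show "{v} \<in> generated T" if "v \<in> \<Union>(generated T)" for v
    using that unfolding Union_generated generated_def by blast
  show "G \<in> generated T" if "F \<in> generated T" "G \<subseteq> F" for F G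
    using that unfolding generated_def by blast
qed blast

text \<open>\<open>p i\<close> is a vertex of the base and \<open>q i\<close> the free end of the
  whisker attached to it. In the application these are a vertex of \<Delta> and the new vertex of
  its colour.\<close>

locale whiskering =
  fixes J :: "'i set" and p q :: "'i \<Rightarrow> 'b"
  assumes finite_J: "finite J" and inj_p: "inj_on p J" and inj_q: "inj_on q J"
    and pq: "\<And>i j. i \<in> J \<Longrightarrow> j \<in> J \<Longrightarrow> p i \<noteq> q j"
begin

definition whiskers :: "'b set set" where "whiskers = (\<lambda>i. {p i, q i}) ` J"

text \<open>These are the families of further facets that may sit on the base. Having at least two
  elements keeps a member from lying inside a whisker, and the conditions survive removal of
  members, as the recursive clause of \<open>grafted\<close> requires.\<close>

definition admissible :: "'b set set \<Rightarrow> bool" where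
  "admissible S \<longleftrightarrow> S \<subseteq> Pow (p ` J) \<and> (\<forall>F\<in>S. 2 \<le> card F) \<and> (\<forall>F\<in>S. \<forall>G\<in>S. F \<subseteq> G \<longrightarrow> F = G)"

lemma admissible_sub: "admissible S \<Longrightarrow> N \<in> S \<Longrightarrow> N \<subseteq> p ` J"
  by (auto simp: admissible_def)

lemma admissible_card: "admissible S \<Longrightarrow> N \<in> S \<Longrightarrow> 2 \<le> card N"
  by (simp add: admissible_def)

lemma admissible_antichain: "admissible S \<Longrightarrow> N \<in> S \<Longrightarrow> M \<in> S \<Longrightarrow> N \<subseteq> M \<Longrightarrow> N = M"
  by (simp add: admissible_def)

lemma q_notin: "admissible S \<Longrightarrow> N \<in> S \<Longrightarrow> i \<in> J \<Longrightarrow> q i \<notin> N"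
proof
  assume "admissible S" "N \<in> S" "i \<in> J" "q i \<in> N"
  then obtain k where "k \<in> J" "q i = p k" using admissible_sub[of S N] by blast
  then show False using pq[OF _ \<open>i \<in> J\<close>, of k] by simp
qed

lemma whiskers_disjoint: "i \<in> J \<Longrightarrow> j \<in> J \<Longrightarrow> i \<noteq> j \<Longrightarrow> {p i, q i} \<inter> {p j, q j} = {}"
  using inj_onD[OF inj_p, of i j] inj_onD[OF inj_q, of i j] pq[of i j] pq[of j i] by auto

lemma facets_whiskered:
  assumes S: "admissible S"
  shows "facets (generated (whiskers \<union> S)) = whiskers \<union> S"
proof (rule facets_generated)
  fix F G assume FG: "F \<in> whiskers \<union> S" "G \<in> whiskers \<union> S" "F \<subseteq> G"
  consider (a) "F \<in> whiskers" | (b) "F \<in> S" "G \<in> S" | (c) "F \<in> S" "G \<in> whiskers"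
    using FG by blast
  then show "F = G"
  proof cases
    case a
    then obtain i where i: "i \<in> J" "F = {p i, q i}" by (auto simp: whiskers_def)
    then have "G \<notin> S" using q_notin[OF S] FG by blast
    then obtain j where j: "j \<in> J" "G = {p j, q j}" using FG by (auto simp: whiskers_def)
    then have "i = j" using whiskers_disjoint[OF i(1) j(1)] FG i by blast
    then show ?thesis using i j by simp
  next
    case b
    then show ?thesis using admissible_antichain[OF S] FG by blast
  next
    case c
    then obtain j where j: "j \<in> J" "G = {p j, q j}" by (auto simp: whiskers_def)
    then have "F \<subseteq> {p j}" using q_notin[OF S c(1) j(1)] FG by blast
    then have "F = {} \<or> F = {p j}" by blast
    then show ?thesis using admissible_card[OF S c(1)] by auto
  qed
qed

text \<open>A facet F on the base is no leaf: each of its vertices also lies on a whisker, so a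
  joint would contain all of F. A whisker meets other facets at most in \<open>p i\<close>, so a
  base facet through \<open>p i\<close> is a joint; if there is none, every other facet is a
  joint.\<close>

lemma leaf_whiskered_iff:
  assumes S: "admissible S"
  shows "leaf (generated (whiskers \<union> S)) F \<longleftrightarrow> F \<in> whiskers"
proof
  assume L: "leaf (generated (whiskers \<union> S)) F"
  show "F \<in> whiskers"
  proof (rule ccontr)
    assume nw: "F \<notin> whiskers"
    then have F: "F \<in> S" using L by (auto simp: leaf_def facets_whiskered[OF S])
    have "F \<noteq> {}" using admissible_card[OF S F] by auto
    then obtain i where i: "i \<in> J" "p i \<in> F"
      using admissible_sub[OF S F] \<open>F \<noteq> {}\<close> by blast
    \<comment> \<open>This whisker is a facet different from F, so F can be a leaf only through a
      joint.\<close>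
    then have "{p i, q i} \<in> whiskers" by (auto simp: whiskers_def)
    then obtain G where G: "G \<in> whiskers \<union> S" "G \<noteq> F"
        "\<And>H. H \<in> whiskers \<union> S \<Longrightarrow> H \<noteq> F \<Longrightarrow> F \<inter> H \<subseteq> G"
      using L nw unfolding leaf_def joint_of_def facets_whiskered[OF S] by auto
    have "F \<subseteq> G"
    proof
      fix v assume v: "v \<in> F"
      then obtain k where k: "k \<in> J" "v = p k" using admissible_sub[OF S F] by blast
      then have "{p k, q k} \<in> whiskers" by (auto simp: whiskers_def)
      moreover have "{p k, q k} \<noteq> F" using nw calculation by metis
      ultimately have "F \<inter> {p k, q k} \<subseteq> G" using G(3)[of "{p k, q k}"] by simp
      with v k show "v \<in> G" by simp
    qed
    moreover have "F \<in> facets (generated (whiskers \<union> S))" "G \<in> facets (generated (whiskers \<union> S))"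
      using F G(1) by (simp_all add: facets_whiskered[OF S])
    ultimately have "G = F" unfolding facets_def by simp
    with G(2) show False by simp
  qed
next
  assume F: "F \<in> whiskers"
  then obtain i where i: "i \<in> J" "F = {p i, q i}" by (auto simp: whiskers_def)
  have meets: "F \<inter> H \<subseteq> {p i} \<and> H \<in> S \<or> F \<inter> H = {}" if H: "H \<in> whiskers \<union> S" "H \<noteq> F" for H
  proof (cases "H \<in> S")
    case True
    then show ?thesis using q_notin[OF S _ i(1)] i by blast
  next
    case False
    then obtain j where j: "j \<in> J" "H = {p j, q j}" using H unfolding whiskers_def by blast
    then show ?thesis using whiskers_disjoint[OF i(1) j(1)] i j H by auto
  qed
  show "leaf (generated (whiskers \<union> S)) F"
  proof (cases "whiskers \<union> S = {F}")
    case True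
    then show ?thesis using facets_whiskered[OF S] unfolding leaf_def by simp
  next
    case False
    have "\<exists>G. G \<in> whiskers \<union> S \<and> G \<noteq> F \<and> (\<forall>H\<in>whiskers \<union> S. H \<noteq> F \<longrightarrow> F \<inter> H \<subseteq> G)"
    proof (cases "\<exists>G\<in>S. p i \<in> G")
      case True
      then obtain G where G: "G \<in> S" "p i \<in> G" by blast
      have "G \<noteq> F" using q_notin[OF S G(1) i(1)] i by blast
      moreover have "F \<inter> H \<subseteq> G" if "H \<in> whiskers \<union> S" "H \<noteq> F" for H
        using meets[OF that] G by blast
      ultimately show ?thesis using G by blast
    next
      case noG: False
      obtain G where G: "G \<in> whiskers \<union> S" "G \<noteq> F" using False F by blast
      moreover have "F \<inter> H \<subseteq> G" if "H \<in> whiskers \<union> S" "H \<noteq> F" for H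
        using meets[OF that] noG by blast
      ultimately show ?thesis by blast
    qed
    then show ?thesis using F unfolding leaf_def joint_of_def facets_whiskered[OF S] by blast
  qed
qed

lemma Union_whiskers: "\<Union>whiskers = p ` J \<union> q ` J"
  by (auto simp: whiskers_def)

lemma Union_admissible: "admissible S \<Longrightarrow> \<Union>S \<subseteq> p ` J"
  using admissible_sub by blast

text \<open>The induction runs on the base facets. Removing one of them keeps the leaves and an
  admissible family, so the recursive clause is met for every base facet, joint or not.\<close>

lemma grafted_whiskered:
  assumes "admissible S"
  shows "grafted (generated (whiskers \<union> S))"
proof -
  have "S \<subseteq> Pow (p ` J)" using assms by (auto simp: admissible_def)
  then have "finite S" using finite_J finite_subset by blast
  then show ?thesis using assms
  proof (induction S rule: finite_psubset_induct)
    case (psubset S)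
    note S = psubset.prems
    show ?case
    proof (rule grafted.intros)
      have "\<Union>(whiskers \<union> S) = p ` J \<union> q ` J"
        unfolding Union_Un_distrib Union_whiskers using Union_admissible[OF S] by blast
      then show "complex_on (\<Union>(generated (whiskers \<union> S))) (generated (whiskers \<union> S))"
        using finite_J by (intro complex_on_generated) simp
      show "facets (generated (whiskers \<union> S)) = whiskers \<union> S"
        by (rule facets_whiskered[OF S])
      show "\<Union>S \<subseteq> \<Union>whiskers" unfolding Union_whiskers using Union_admissible[OF S] by blast
      show "whiskers = {F. leaf (generated (whiskers \<union> S)) F}"
        by (simp add: leaf_whiskered_iff[OF S])
      show disj: "whiskers \<inter> S = {}"
        using q_notin[OF S] unfolding whiskers_def by blast
      show "pairwise disjnt whiskers"
        unfolding pairwise_def disjnt_def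
      proof (intro ballI impI)
        fix F H assume FH: "F \<in> whiskers" "H \<in> whiskers" "F \<noteq> H"
        then obtain i j where "i \<in> J" "j \<in> J" "F = {p i, q i}" "H = {p j, q j}"
          unfolding whiskers_def by blast
        with FH whiskers_disjoint[of i j] show "F \<inter> H = {}" by auto
      qed
      fix G assume G: "G \<in> S"
      have eq: "whiskers \<union> S - {G} = whiskers \<union> (S - {G})" using disj G by blast
      have "admissible (S - {G})" using S unfolding admissible_def by blast
      then show "grafted (generated (facets (generated (whiskers \<union> S)) - {G}))"
        unfolding facets_whiskered[OF S] eq using psubset.IH[of "S - {G}"] G by blast
    qed
  qed
qed

lemma whiskered_whiskered:
  assumes "admissible S"
  shows "whiskered (generated (whiskers \<union> S))"
proof -
  have "dimension F = 1" if "F \<in> whiskers" for F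
    using that pq by (auto simp: whiskers_def dimension_def)
  then show ?thesis
    using grafted_whiskered[OF assms] leaf_whiskered_iff[OF assms] by (simp add: whiskered_def)
qed

end

section \<open>Minimal nonfaces with whiskers\<close>

lemma minimal_nonface:
  assumes "finite W" "W \<notin> \<Delta>"
  obtains N where "N \<subseteq> W" "N \<notin> \<Delta>" "\<And>M. M \<subset> N \<Longrightarrow> M \<in> \<Delta>"
proof -
  have "\<exists>N\<subseteq>W. N \<notin> \<Delta> \<and> (\<forall>M. M \<subset> N \<longrightarrow> M \<in> \<Delta>)"
    using assms
  proof (induction W rule: finite_psubset_induct)
    case (psubset W)
    then show ?case by (metis psubset_imp_subset subset_trans subset_refl)
  qed
  then show thesis using that by blast
qed

context coloured_complex
begin

lemma whiskered_if_discrete: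
  assumes "discrete_colouring V s c"
  shows "\<exists>\<Gamma>. whiskered \<Gamma> \<and> colour_complex \<Delta> s c = Ind \<Gamma>"
proof -
  obtain x where x: "bij_betw x {1..s} V" and c: "\<And>j. j \<in> {1..s} \<Longrightarrow> c j = {x j}"
    by (rule discrete_enumeration[OF assms]) blast
  have xV: "x ` {1..s} = V" using x by (simp add: bij_betw_def)
  define p q :: "nat \<Rightarrow> 'a + nat" where "p = (\<lambda>j. Inl (x j))" and "q = Inr"
  interpret whiskering "{1..s}" p q
  proof
    show "inj_on p {1..s}" 
      using comp_inj_on[OF bij_betw_imp_inj_on[OF x] inj_on_subset[OF inj_Inl subset_UNIV]]
      by (simp add: p_def comp_def)
    show "inj_on q {1..s}" by (simp add: q_def)
  qed (simp_all add: p_def q_def)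
  have pJ: "p ` {1..s} = Inl ` V" unfolding p_def xV[symmetric] by (simp add: image_image)
  define M where "M = {N. N \<subseteq> V \<and> N \<notin> \<Delta> \<and> (\<forall>N'. N' \<subset> N \<longrightarrow> N' \<in> \<Delta>)}"
  define S where "S = (\<lambda>N. Inl ` N :: ('a + nat) set) ` M"
  have anti: "N = N'" if "N \<in> M" "N' \<in> M" "N \<subseteq> N'" for N N'
    using that unfolding M_def by blast
  have S: "admissible S"
    unfolding admissible_def
  proof (intro conjI ballI allI impI)
    show "S \<subseteq> Pow (p ` {1..s})" unfolding pJ S_def M_def by blast
    fix F assume F: "F \<in> S"
    then obtain N where N: "N \<in> M" "F = Inl ` N" by (auto simp: S_def)
    have "finite N" using N finite_V finite_subset unfolding M_def by blast
    \<comment> \<open>There are no ghost vertices: the empty set and the singletons in V are faces,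
      so a minimal nonface has at least two elements.\<close>
    moreover have "N \<noteq> {}" "N \<noteq> {v}" for v using N empty_face vertex unfolding M_def by blast+
    ultimately have "card N \<noteq> 0" "card N \<noteq> 1" by (auto simp: card_1_singleton_iff)
    then show "2 \<le> card F" using N by (simp add: card_image)
    fix G assume G: "G \<in> S" "F \<subseteq> G"
    then obtain N' where N': "N' \<in> M" "G = Inl ` N'" by (auto simp: S_def)
    then have "N \<subseteq> N'" using G N by (simp add: inj_image_subset_iff)
    then show "F = G" using anti[OF N(1) N'(1)] N N' by simp
  qed
  have wh: "whiskers = (\<lambda>j. {Inl (x j), Inr j}) ` {1..s}"
    unfolding whiskers_def unfolding p_def q_def ..
  let ?\<Gamma> = "generated (whiskers \<union> S)"
  \<comment> \<open>\<open>Ind\<close> takes its ground set from the complex itself. The whiskers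
    alone cover it, including the vertices that lie in no minimal nonface.\<close>
  have Un: "\<Union>?\<Gamma> = Inl ` V \<union> Inr ` {1..s}"
  proof -
    have "\<Union>?\<Gamma> = p ` {1..s} \<union> q ` {1..s}"
      unfolding Union_generated Union_Un_distrib Union_whiskers using Union_admissible[OF S] by blast
    then show ?thesis unfolding pJ q_def .
  qed
  have "colour_complex \<Delta> s c = Ind ?\<Gamma>"
  proof (intro equalityI subsetI)
    fix W assume W: "W \<in> colour_complex \<Delta> s c"
    then have f: "{v. Inl v \<in> W} \<in> \<Delta>" and r: "\<And>j. Inr j \<in> W \<Longrightarrow> j \<in> {1..s}"
      and d: "\<And>j. Inr j \<in> W \<Longrightarrow> Inl (x j) \<notin> W"
      using c by (auto simp: colour_complex_iff)
    have "W \<subseteq> \<Union>?\<Gamma>"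
    proof
      fix z assume "z \<in> W"
      then show "z \<in> \<Union>?\<Gamma>" unfolding Un using face_sub[OF f] r by (cases z) auto
    qed
    moreover have "\<not> F \<subseteq> W" if "F \<in> whiskers \<union> S" for F
      using that
    proof
      assume "F \<in> whiskers"
      then show ?thesis using d unfolding wh by blast
    next
      assume "F \<in> S"
      then obtain N where N: "N \<in> M" "F = Inl ` N" by (auto simp: S_def)
      show ?thesis
      proof
        assume "F \<subseteq> W"
        then have "N \<subseteq> {v. Inl v \<in> W}" using N by blast
        then have "N \<in> \<Delta>" by (rule down[OF f])
        then show False using N(1) by (simp add: M_def)
      qed
    qed
    ultimately show "W \<in> Ind ?\<Gamma>"
      unfolding Ind_def facets_whiskered[OF S] by blast
  next
    fix W assume "W \<in> Ind ?\<Gamma>"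
    then have WU: "W \<subseteq> Inl ` V \<union> Inr ` {1..s}" and no: "\<And>F. F \<in> whiskers \<union> S \<Longrightarrow> \<not> F \<subseteq> W"
      unfolding Ind_def facets_whiskered[OF S] Un by blast+
    have WV: "{v. Inl v \<in> W} \<subseteq> V" using WU by auto
    have "{v. Inl v \<in> W} \<in> \<Delta>"
    proof (rule ccontr)
      assume "{v. Inl v \<in> W} \<notin> \<Delta>"
      then obtain N where N: "N \<subseteq> {v. Inl v \<in> W}" "N \<notin> \<Delta>" "\<And>M. M \<subset> N \<Longrightarrow> M \<in> \<Delta>"
        using minimal_nonface WV finite_V finite_subset by metis
      then have "Inl ` N \<in> S" using WV unfolding S_def M_def by blast
      then show False using no[of "Inl ` N"] N by blast
    qed
    moreover have "j \<in> {1..s} \<and> (\<forall>v\<in>c j. Inl v \<notin> W)" if "Inr j \<in> W" for j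
    proof -
      have j: "j \<in> {1..s}" using that WU by auto
      then have "{Inl (x j), Inr j} \<in> whiskers" unfolding wh by (rule imageI)
      then show ?thesis using no[of "{Inl (x j), Inr j}"] that j c by auto
    qed
    ultimately show "W \<in> colour_complex \<Delta> s c" by (simp add: colour_complex_iff)
  qed
  then show ?thesis using whiskered_whiskered[OF S] by blast
qed

text \<open>The independence complex of \<open>\<Gamma>\<close> determines the facets of \<open>\<Gamma>\<close> on its vertices as
  minimal nonfaces. The leaf through \<open>y\<^sub>j\<close> is therefore \<open>{z, y\<^sub>j}\<close> with \<open>z\<close> in class \<open>j\<close>; another
  element \<open>z'\<close> of that class yields facets \<open>{z', y\<^sub>j}\<close> and \<open>{z, z'}\<close>, and a joint would
  contain the leaf.\<close>

lemma class_trivial_if_grafted: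
  assumes gr: "grafted \<Gamma>" and Ind: "colour_complex \<Delta> s c = Ind \<Gamma>"
    and j: "j \<in> {1..s}" and ab: "a \<in> c j" "b \<in> c j"
  shows "a = b"
proof (rule ccontr)
  assume "a \<noteq> b"
  have facet_minimal: "F = H" if "F \<in> facets \<Gamma>" "H \<in> facets \<Gamma>" "F \<subseteq> H" for F H
    using that by (auto simp: facets_def)
  have vert: "{Inl v} \<in> Ind \<Gamma>" if "v \<in> V" for v
    unfolding Ind[symmetric] colour_complex_iff using vertex[OF that] by simp
  have colv: "{Inr i} \<in> Ind \<Gamma>" if "i \<in> {1..s}" for i
    unfolding Ind[symmetric] colour_complex_iff using that empty_face by simp
  \<comment> \<open>A dependent set contains a facet of \<Gamma>; as both singletons are
    independent, this facet is the whole pair.\<close>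
  have pair: "{u, w} \<in> facets \<Gamma>"
    if uw: "{u} \<in> Ind \<Gamma>" "{w} \<in> Ind \<Gamma>" "{u, w} \<notin> colour_complex \<Delta> s c" for u w
  proof -
    obtain F where F: "F \<in> facets \<Gamma>" "F \<subseteq> {u, w}"
      using uw unfolding Ind Ind_def by auto
    moreover have "\<not> F \<subseteq> {u}" "\<not> F \<subseteq> {w}" using uw F unfolding Ind_def by auto
    ultimately have "F = {u, w}" by blast
    with F show ?thesis by simp
  qed
  have cV: "v \<in> V" if "v \<in> c j" for v using class_sub[OF j] that by blast
  have edge_y: "{Inl v, Inr j} \<in> facets \<Gamma>" if "v \<in> c j" for v
    using that vert[OF cV[OF that]] colv[OF j] by (intro pair) (auto simp: colour_complex_iff)
  have edge_x: "{Inl v, Inl w} \<in> facets \<Gamma>" if "v \<in> c j" "w \<in> c j" "v \<noteq> w" for v w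
  proof (intro pair vert cV that)
    show "{Inl v, Inl w} \<notin> colour_complex \<Delta> s c"
    proof
      assume "{Inl v, Inl w} \<in> colour_complex \<Delta> s c"
      then have "{u. Inl u \<in> {Inl v, Inl w :: 'a + nat}} \<in> \<Delta>" by (simp add: colour_complex_iff)
      then show False using class_unique[OF _ _ _ j that(1,2)] that(3) by auto
    qed
  qed
  \<comment> \<open>The vertices of the facets that are not leaves are confined to the leaves, so
    every vertex of a facet, here \<open>y\<^sub>j\<close>, lies in a leaf.\<close>
  obtain L where L: "leaf \<Gamma> L" "Inr j \<in> L"
    using gr
  proof cases
    case (1 \<F> \<G>)
    have "Inr j \<in> \<Union>(facets \<Gamma>)" using edge_y[OF ab(1)] by blast
    then have "Inr j \<in> \<Union>\<F>" using 1 by blast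
    then show thesis using that 1 by blast
  qed
  have Lf: "L \<in> facets \<Gamma>" using L by (simp add: leaf_def)
  \<comment> \<open>A facet minus one vertex contains no facet and is therefore independent. Adding
    \<open>y\<^sub>j\<close> back destroys this, which can only be due to a vertex of class j in
    L.\<close>
  have "L - {Inr j} \<in> Ind \<Gamma>"
  proof -
    have "L - {Inr j} \<subseteq> \<Union>\<Gamma>" using Lf by (auto simp: facets_def)
    moreover have "\<not> F \<subseteq> L - {Inr j}" if "F \<in> facets \<Gamma>" for F
      using facet_minimal[OF that Lf] L by blast
    ultimately show ?thesis by (auto simp: Ind_def)
  qed
  moreover have "L \<notin> Ind \<Gamma>" using Lf by (auto simp: Ind_def)
  ultimately obtain z where z: "z \<in> c j" "Inl z \<in> L"
    using j unfolding Ind[symmetric] by (auto simp: colour_complex_iff)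
  then have Leq: "L = {Inl z, Inr j}"
    using facet_minimal[OF edge_y[OF z(1)] Lf] L by blast
  obtain z' where z': "z' \<in> c j" "z' \<noteq> z" using ab \<open>a \<noteq> b\<close> by metis
  have ne: "{Inl z', Inr j} \<noteq> L" "{Inl z, Inl z'} \<noteq> L" using Leq z' by (auto simp: doubleton_eq_iff)
  have "facets \<Gamma> \<noteq> {L}" using edge_y[OF z'(1)] ne(1) by (metis singletonD)
  then obtain G where G: "joint_of \<Gamma> L G" using L(1) unfolding leaf_def by blast
  then have joint: "\<And>H. H \<in> facets \<Gamma> \<Longrightarrow> H \<noteq> L \<Longrightarrow> L \<inter> H \<subseteq> G"
    unfolding joint_of_def by blast
  \<comment> \<open>The facet \<open>{Inl z', Inr j}\<close> forces \<open>y\<^sub>j\<close> into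
    the joint, and the facet \<open>{Inl z, Inl z'}\<close> forces z into it.\<close>
  have "L \<subseteq> G"
    using joint[OF edge_y[OF z'(1)] ne(1)] joint[OF edge_x[OF z(1) z'(1) z'(2)[symmetric]] ne(2)]
    unfolding Leq by blast
  then show False using G facet_minimal[of L G] unfolding joint_of_def by blast
qed

end

section \<open>Subcomplexes of the cross-polytope\<close>

lemma continuous_on_coordinate: "continuous_on A (\<lambda>x. x i :: real)"
  by (rule continuous_on_subset[OF continuous_on_product_coordinates]) auto

lemma homeomorphic_space_top_of_set:
  assumes "continuous_on S f" "continuous_on T g" "f \<in> S \<rightarrow> T" "g \<in> T \<rightarrow> S"
    and "\<And>x. x \<in> S \<Longrightarrow> g (f x) = x" "\<And>y. y \<in> T \<Longrightarrow> f (g y) = y"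
  shows "top_of_set S homeomorphic_space top_of_set T"
  unfolding homeomorphic_space_def homeomorphic_maps_def
  using assms by (intro exI[of _ f] exI[of _ g]) auto

text \<open>The map h carries rays to rays, and each ray meets the level sets M = 1 and N = 1
  exactly once, so h followed by rescaling along rays is a homeomorphism between them. A change of
  norm (with h the identity) and a change of cone are both instances.\<close>

lemma homeomorphic_space_homogeneous:
  fixes C D :: "(nat \<Rightarrow> real) set"
  assumes h: "continuous_on C h" "h \<in> C \<rightarrow> D" and k: "continuous_on D k" "k \<in> D \<rightarrow> C"
    and kh: "\<And>z. z \<in> C \<Longrightarrow> k (h z) = z" and hk: "\<And>w. w \<in> D \<Longrightarrow> h (k w) = w"
    and C: "\<And>z r. z \<in> C \<Longrightarrow> 0 < r \<Longrightarrow> (\<lambda>i. r * z i) \<in> C \<and> h (\<lambda>i. r * z i) = (\<lambda>i. r * h z i)"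
    and D: "\<And>w r. w \<in> D \<Longrightarrow> 0 < r \<Longrightarrow> (\<lambda>i. r * w i) \<in> D \<and> k (\<lambda>i. r * w i) = (\<lambda>i. r * k w i)"
    and M: "continuous_on C M" "\<And>z. z \<in> C \<Longrightarrow> 0 < M z"
      "\<And>z r. z \<in> C \<Longrightarrow> 0 < r \<Longrightarrow> M (\<lambda>i. r * z i) = r * M z"
    and N: "continuous_on D N" "\<And>w. w \<in> D \<Longrightarrow> 0 < N w"
      "\<And>w r. w \<in> D \<Longrightarrow> 0 < r \<Longrightarrow> N (\<lambda>i. r * w i) = r * N w"
  shows "top_of_set {z \<in> C. M z = (1::real)} homeomorphic_space top_of_set {w \<in> D. N w = (1::real)}"
proof (rule homeomorphic_space_top_of_set[where f = "\<lambda>z i. inverse (N (h z)) * h z i"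
      and g = "\<lambda>w i. inverse (M (k w)) * k w i"])
  have hD: "h z \<in> D" if "z \<in> C" for z using h(2) that by blast
  have kC: "k w \<in> C" if "w \<in> D" for w using k(2) that by blast
  have Nne: "N (h z) \<noteq> 0" if "z \<in> C" for z using N(2)[OF hD[OF that]] by simp
  have Mne: "M (k w) \<noteq> 0" if "w \<in> D" for w using M(2)[OF kC[OF that]] by simp
  have "continuous_on C (\<lambda>z. N (h z))"
    using h hD by (intro continuous_on_compose2[OF N(1)]) auto
  then have "continuous_on C (\<lambda>z i. inverse (N (h z)) * h z i)"
    using continuous_on_product_then_coordinatewise[OF h(1)] Nne
    by (intro continuous_intros) auto
  then show "continuous_on {z \<in> C. M z = 1} (\<lambda>z i. inverse (N (h z)) * h z i)"
    by (rule continuous_on_subset) blast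
  have "continuous_on D (\<lambda>w. M (k w))"
    using k kC by (intro continuous_on_compose2[OF M(1)]) auto
  then have "continuous_on D (\<lambda>w i. inverse (M (k w)) * k w i)"
    using continuous_on_product_then_coordinatewise[OF k(1)] Mne
    by (intro continuous_intros) auto
  then show "continuous_on {w \<in> D. N w = 1} (\<lambda>w i. inverse (M (k w)) * k w i)"
    by (rule continuous_on_subset) blast
  show "(\<lambda>z i. inverse (N (h z)) * h z i) \<in> {z \<in> C. M z = 1} \<rightarrow> {w \<in> D. N w = 1}"
  proof
    fix z assume "z \<in> {z \<in> C. M z = 1}"
    then have z: "h z \<in> D" using hD by simp
    then show "(\<lambda>i. inverse (N (h z)) * h z i) \<in> {w \<in> D. N w = 1}"
      using D[OF z] N(3)[OF z] N(2)[OF z] by simp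
  qed
  show "(\<lambda>w i. inverse (M (k w)) * k w i) \<in> {w \<in> D. N w = 1} \<rightarrow> {z \<in> C. M z = 1}"
  proof
    fix w assume "w \<in> {w \<in> D. N w = 1}"
    then have w: "k w \<in> C" using kC by simp
    then show "(\<lambda>i. inverse (M (k w)) * k w i) \<in> {z \<in> C. M z = 1}"
      using C[OF w] M(3)[OF w] M(2)[OF w] by simp
  qed
  fix z assume "z \<in> {z \<in> C. M z = 1}"
  then have z: "z \<in> C" "M z = 1" by auto
  \<comment> \<open>Homogeneity of k moves the positive factor out, and M z = 1 lets the outer
    normalization cancel it.\<close>
  have "k (\<lambda>i. inverse (N (h z)) * h z i) = (\<lambda>i. inverse (N (h z)) * z i)"
    using D[OF hD[OF z(1)]] N(2)[OF hD[OF z(1)]] kh[OF z(1)] by simp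
  moreover have "M (\<lambda>i. inverse (N (h z)) * z i) = inverse (N (h z))"
    using M(3)[OF z(1)] N(2)[OF hD[OF z(1)]] z(2) by simp
  ultimately show "(\<lambda>i. inverse (M (k (\<lambda>i. inverse (N (h z)) * h z i))) *
      k (\<lambda>i. inverse (N (h z)) * h z i) i) = z"
    using Nne[OF z(1)] by (simp add: mult.assoc[symmetric])
next
  have kC: "k w \<in> C" if "w \<in> D" for w using k(2) that by blast
  fix w assume "w \<in> {w \<in> D. N w = 1}"
  then have w: "w \<in> D" "N w = 1" by auto
  have Mpos: "0 < M (k w)" using M(2)[OF kC[OF w(1)]] .
  have "h (\<lambda>i. inverse (M (k w)) * k w i) = (\<lambda>i. inverse (M (k w)) * w i)"
    using C[OF kC[OF w(1)]] Mpos hk[OF w(1)] by simp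
  moreover have "N (\<lambda>i. inverse (M (k w)) * w i) = inverse (M (k w))"
    using N(3)[OF w(1)] Mpos w(2) by simp
  ultimately show "(\<lambda>i. inverse (N (h (\<lambda>i. inverse (M (k w)) * k w i))) *
      h (\<lambda>i. inverse (M (k w)) * k w i) i) = w"
    using Mpos by (simp add: mult.assoc[symmetric])
qed

text \<open>Vectors of n-space are sequences vanishing from index n on, as in
  \<open>Euclidean_space\<close>. The origin is left out so that every norm is positive and can be
  divided by.\<close>

definition vectors :: "nat \<Rightarrow> (nat \<Rightarrow> real) set" where
  "vectors n = {z. (\<forall>i\<ge>n. z i = 0) \<and> (\<exists>i<n. z i \<noteq> 0)}"

definition positive_part :: "nat \<Rightarrow> (nat \<Rightarrow> real) \<Rightarrow> nat set" where
  "positive_part n z = {i. i < n \<and> 0 < z i}"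

definition l1_norm :: "nat \<Rightarrow> (nat \<Rightarrow> real) \<Rightarrow> real" where
  "l1_norm n z = (\<Sum>i<n. \<bar>z i\<bar>)"

definition l2_norm :: "nat \<Rightarrow> (nat \<Rightarrow> real) \<Rightarrow> real" where
  "l2_norm n z = sqrt (\<Sum>i<n. z i ^ 2)"

lemma continuous_on_l1_norm: "continuous_on A (l1_norm n)"
  unfolding l1_norm_def[abs_def]
  by (intro continuous_intros continuous_on_coordinate)

lemma continuous_on_l2_norm: "continuous_on A (l2_norm n)"
  unfolding l2_norm_def[abs_def]
  by (intro continuous_intros continuous_on_coordinate)

lemma l1_norm_pos: "z \<in> vectors n \<Longrightarrow> 0 < l1_norm n z"
  unfolding vectors_def l1_norm_def by (auto intro: sum_pos2)

lemma l2_norm_pos: "z \<in> vectors n \<Longrightarrow> 0 < l2_norm n z"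
  unfolding vectors_def l2_norm_def by (auto intro: sum_pos2)

lemma l1_norm_scale: "0 < r \<Longrightarrow> l1_norm n (\<lambda>i. r * z i) = r * l1_norm n z"
  by (simp add: l1_norm_def abs_mult sum_distrib_left)

lemma l2_norm_scale: "0 < r \<Longrightarrow> l2_norm n (\<lambda>i. r * z i) = r * l2_norm n z"
  by (simp add: l2_norm_def power_mult_distrib sum_distrib_left[symmetric] real_sqrt_mult)

lemma vectors_scale: "z \<in> vectors n \<Longrightarrow> 0 < r \<Longrightarrow> (\<lambda>i. r * z i) \<in> vectors n"
  by (auto simp: vectors_def)

lemma positive_part_scale: "0 < r \<Longrightarrow> positive_part n (\<lambda>i. r * z i) = positive_part n z"
  by (auto simp: positive_part_def zero_less_mult_iff)

lemma powertop_real_eq_euclidean: "subtopology (powertop_real UNIV) S = top_of_set S"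
  by (simp add: euclidean_product_topology)

lemma nsphere_eq: "nsphere m = top_of_set {w \<in> vectors (Suc m). l2_norm (Suc m) w = 1}"
proof -
  have "{x. (\<forall>i\<ge>Suc m. x i = 0)} \<inter> {x. (\<Sum>i\<le>m. x i ^ 2) = 1} =
      {w \<in> vectors (Suc m). l2_norm (Suc m) w = 1}"
    by (auto simp: vectors_def l2_norm_def lessThan_Suc_atMost intro: ccontr)
  then show ?thesis
    unfolding nsphere_def Euclidean_space_def subtopology_subtopology powertop_real_eq_euclidean by simp
qed

lemma nball_eq: "nball m = top_of_set {u. (\<forall>i\<ge>m. u i = 0) \<and> (\<Sum>i<m. u i ^ 2) \<le> 1}"
  unfolding nball_def Euclidean_space_def subtopology_subtopology powertop_real_eq_euclidean
  by (simp add: Collect_conj_eq)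

lemma l1_sphere_homeomorphic_nsphere:
  "top_of_set {z \<in> vectors (Suc m). l1_norm (Suc m) z = 1} homeomorphic_space nsphere m"
  unfolding nsphere_eq
  by (rule homeomorphic_space_homogeneous[where h = "\<lambda>z. z" and k = "\<lambda>z. z"])
    (auto simp: vectors_scale l1_norm_pos l2_norm_pos l1_norm_scale l2_norm_scale
      continuous_on_l1_norm continuous_on_l2_norm)

text \<open>The lower hemisphere is the graph of minus a square root over the ball, so this root
  inverts the projection that forgets coordinate m.\<close>

lemma hemisphere_homeomorphic_nball:
  "top_of_set {w \<in> vectors (Suc m) \<inter> {w. w m \<le> 0}. l2_norm (Suc m) w = 1} homeomorphic_space nball m"
  unfolding nball_eq
proof (rule homeomorphic_space_top_of_set[where f = "\<lambda>w i. if i < m then w i else 0" and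
      g = "\<lambda>u i. if i < m then u i else if i = m then - sqrt (1 - (\<Sum>i<m. u i ^ 2)) else 0"])
  show "continuous_on {w \<in> vectors (Suc m) \<inter> {w. w m \<le> 0}. l2_norm (Suc m) w = 1}
      (\<lambda>w i. if i < m then w i else 0)"
  proof (rule continuous_on_coordinatewise_then_product)
    fix i show "continuous_on {w \<in> vectors (Suc m) \<inter> {w. w m \<le> 0}. l2_norm (Suc m) w = 1}
      (\<lambda>w. if i < m then w i else 0)"
      by (cases "i < m") (auto intro: continuous_on_coordinate)
  qed
  show "continuous_on {u. (\<forall>i\<ge>m. u i = 0) \<and> (\<Sum>i<m. u i ^ 2) \<le> 1}
     (\<lambda>u i. if i < m then u i else if i = m then - sqrt (1 - (\<Sum>i<m. u i ^ 2)) else 0)"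
  proof (rule continuous_on_coordinatewise_then_product)
    fix i
    have "continuous_on {u. (\<forall>i\<ge>m. u i = 0) \<and> (\<Sum>i<m. u i ^ 2) \<le> 1}
       (\<lambda>u. - sqrt (1 - (\<Sum>i<m. u i ^ 2)))"
      by (intro continuous_intros continuous_on_coordinate)
    then show "continuous_on {u. (\<forall>i\<ge>m. u i = 0) \<and> (\<Sum>i<m. u i ^ 2) \<le> 1}
       (\<lambda>u. if i < m then u i else if i = m then - sqrt (1 - (\<Sum>i<m. u i ^ 2)) else 0)"
      by (cases "i < m"; cases "i = m")
        (auto intro: continuous_on_coordinate)
  qed
  show "(\<lambda>w i. if i < m then w i else 0) \<in> {w \<in> vectors (Suc m) \<inter> {w. w m \<le> 0}. l2_norm (Suc m) w = 1}
      \<rightarrow> {u. (\<forall>i\<ge>m. u i = 0) \<and> (\<Sum>i<m. u i ^ 2) \<le> 1}"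
  proof
    fix w assume "w \<in> {w \<in> vectors (Suc m) \<inter> {w. w m \<le> 0}. l2_norm (Suc m) w = 1}"
    then have "(\<Sum>i<m. w i ^ 2) + w m ^ 2 = 1" by (simp add: l2_norm_def)
    moreover have "0 \<le> w m ^ 2" by simp
    ultimately have "(\<Sum>i<m. w i ^ 2) \<le> 1" by linarith
    then show "(\<lambda>i. if i < m then w i else 0) \<in> {u. (\<forall>i\<ge>m. u i = 0) \<and> (\<Sum>i<m. u i ^ 2) \<le> 1}"
      by simp
  qed
  show "(\<lambda>u i. if i < m then u i else if i = m then - sqrt (1 - (\<Sum>i<m. u i ^ 2)) else 0)
    \<in> {u. (\<forall>i\<ge>m. u i = 0) \<and> (\<Sum>i<m. u i ^ 2) \<le> 1}
    \<rightarrow> {w \<in> vectors (Suc m) \<inter> {w. w m \<le> 0}. l2_norm (Suc m) w = 1}"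
  proof
    fix u :: "nat \<Rightarrow> real" assume u: "u \<in> {u. (\<forall>i\<ge>m. u i = 0) \<and> (\<Sum>i<m. u i ^ 2) \<le> 1}"
    let ?w = "\<lambda>i. if i < m then u i else if i = m then - sqrt (1 - (\<Sum>i<m. u i ^ 2)) else 0"
    have sq: "(\<Sum>i<Suc m. ?w i ^ 2) = 1" using u by simp
    have "\<exists>i<Suc m. ?w i \<noteq> 0"
    proof (rule ccontr)
      assume "\<not> (\<exists>i<Suc m. ?w i \<noteq> 0)"
      then have "(\<Sum>i<Suc m. ?w i ^ 2) = 0" by (intro sum.neutral) auto
      with sq show False by simp
    qed
    then have "?w \<in> vectors (Suc m)" unfolding vectors_def by auto
    with sq u show "?w \<in> {w \<in> vectors (Suc m) \<inter> {w. w m \<le> 0}. l2_norm (Suc m) w = 1}"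
      unfolding l2_norm_def by simp
  qed
  fix w assume w: "w \<in> {w \<in> vectors (Suc m) \<inter> {w. w m \<le> 0}. l2_norm (Suc m) w = 1}"
  then have "(\<Sum>i<m. w i ^ 2) + w m ^ 2 = 1" by (simp add: l2_norm_def)
  then have "1 - (\<Sum>i<m. w i ^ 2) = w m ^ 2" by linarith
  then have "- sqrt (1 - (\<Sum>i<m. w i ^ 2)) = w m" using w by simp
  then show "(\<lambda>i. if i < m then if i < m then w i else 0 else if i = m then
      - sqrt (1 - (\<Sum>i<m. (if i < m then w i else 0) ^ 2)) else 0) = w"
    using w by (auto simp: vectors_def)
qed (auto simp: fun_eq_iff)

section \<open>Straightening a proper cone to a half-space\<close>

lemma continuous_on_Max_image:
  fixes f :: "'i \<Rightarrow> 'x::topological_space \<Rightarrow> real"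
  assumes "finite I" "I \<noteq> {}" "\<And>i. i \<in> I \<Longrightarrow> continuous_on A (f i)"
  shows "continuous_on A (\<lambda>x. Max ((\<lambda>i. f i x) ` I))"
  using assms
proof (induction I rule: finite_ne_induct)
  case (insert i I)
  then have "continuous_on A (\<lambda>x. max (f i x) (Max ((\<lambda>i. f i x) ` I)))"
    by (intro continuous_intros) auto
  then show ?case using insert.hyps by simp
qed auto

lemma continuous_on_Min_image:
  fixes f :: "'i \<Rightarrow> 'x::topological_space \<Rightarrow> real"
  assumes "finite I" "I \<noteq> {}" "\<And>i. i \<in> I \<Longrightarrow> continuous_on A (f i)"
  shows "continuous_on A (\<lambda>x. Min ((\<lambda>i. f i x) ` I))"
  using assms
proof (induction I rule: finite_ne_induct)
  case (insert i I)
  then have "continuous_on A (\<lambda>x. min (f i x) (Min ((\<lambda>i. f i x) ` I)))"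
    by (intro continuous_intros) auto
  then show ?case using insert.hyps by simp
qed auto

locale proper_subcomplex =
  fixes m :: nat and D :: "nat set set"
  assumes down_closed: "I \<in> D \<Longrightarrow> J \<subseteq> I \<Longrightarrow> J \<in> D" and empty_in: "{} \<in> D" and proper: "{..m} \<notin> D"
begin

definition nonfaces :: "nat set set" where "nonfaces = {N. N \<subseteq> {..m} \<and> N \<notin> D}"

text \<open>This is the least t such that subtracting t from the coordinates 0, ..., m of z makes
  the positive part a face. The max-min formula makes continuity and homogeneity visible. The minima
  are over nonempty sets because the empty set is a face, the maximum because \<open>{..m}\<close>
  is not.\<close>

definition height :: "(nat \<Rightarrow> real) \<Rightarrow> real" where
  "height z = Max ((\<lambda>N. Min (z ` N)) ` nonfaces)"

lemma finite_nonfaces: "finite nonfaces"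
  by (rule finite_subset[of _ "Pow {..m}"]) (auto simp: nonfaces_def)

lemma nonfaces_ne: "nonfaces \<noteq> {}"
  using proper by (auto simp: nonfaces_def)

lemma nonface: "N \<in> nonfaces \<Longrightarrow> finite N" "N \<in> nonfaces \<Longrightarrow> N \<noteq> {}"
  using empty_in finite_subset[of N "{..m}"] by (auto simp: nonfaces_def)

lemma height_cong: "(\<And>i. i \<le> m \<Longrightarrow> z i = w i) \<Longrightarrow> height z = height w"
  unfolding height_def
  by (intro arg_cong[where f = Max] arg_cong[where f = Min] image_cong refl) (auto simp: nonfaces_def)

text \<open>The maximum is positive exactly if z is positive on some nonface, which by downward
  closure means that the whole positive part is a nonface.\<close>

lemma height_pos_iff: "0 < height z \<longleftrightarrow> positive_part (Suc m) z \<notin> D"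
proof -
  have "0 < height z \<longleftrightarrow> (\<exists>N\<in>nonfaces. 0 < Min (z ` N))"
    unfolding height_def using finite_nonfaces nonfaces_ne by (subst Max_gr_iff) auto
  also have "\<dots> \<longleftrightarrow> (\<exists>N\<in>nonfaces. \<forall>i\<in>N. 0 < z i)"
    using nonface by (intro bex_cong refl) simp
  also have "\<dots> \<longleftrightarrow> positive_part (Suc m) z \<notin> D"
  proof
    assume "\<exists>N\<in>nonfaces. \<forall>i\<in>N. 0 < z i"
    then obtain N where N: "N \<in> nonfaces" "\<forall>i\<in>N. 0 < z i" by blast
    then have "N \<subseteq> positive_part (Suc m) z" by (auto simp: nonfaces_def positive_part_def)
    then show "positive_part (Suc m) z \<notin> D" using N(1) down_closed by (auto simp: nonfaces_def)
  next
    assume "positive_part (Suc m) z \<notin> D"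
    then have "positive_part (Suc m) z \<in> nonfaces" by (auto simp: nonfaces_def positive_part_def)
    then show "\<exists>N\<in>nonfaces. \<forall>i\<in>N. 0 < z i" by (rule bexI[rotated]) (simp add: positive_part_def)
  qed
  finally show ?thesis .
qed

lemma height_shift: "height (\<lambda>i. z i + t) = height z + t"
proof -
  have "height (\<lambda>i. z i + t) = Max ((\<lambda>N. Min (z ` N) + t) ` nonfaces)"
    unfolding height_def using nonface
    by (intro arg_cong[where f = Max] image_cong refl Min_add_commute) auto
  also have "\<dots> = height z + t"
    unfolding height_def using finite_nonfaces nonfaces_ne by (rule Max_add_commute)
  finally show ?thesis .
qed

lemma height_scale:
  assumes "0 < r" shows "height (\<lambda>i. r * z i) = r * height z"
proof -
  have mono: "mono (\<lambda>x::real. r * x)" using assms by (intro monoI mult_left_mono) auto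
  have "height (\<lambda>i. r * z i) = Max ((\<lambda>N. r * Min (z ` N)) ` nonfaces)"
    unfolding height_def using nonface
    by (intro arg_cong[where f = Max] image_cong refl) (subst mono_Min_commute[OF mono], auto simp: image_image)
  also have "\<dots> = r * height z"
    unfolding height_def using finite_nonfaces nonfaces_ne
    by (subst mono_Max_commute[OF mono]) (auto simp: image_image)
  finally show ?thesis .
qed

lemma continuous_on_height: "continuous_on A height"
  unfolding height_def[abs_def]
  by (intro continuous_on_Max_image continuous_on_Min_image finite_nonfaces nonfaces_ne nonface
      continuous_on_coordinate) auto

text \<open>The cone of vectors whose positive part is a face is \<open>{z. height z \<le> 0}\<close>, the half-space
  below coordinate \<open>m\<close> is \<open>{w. w m \<le> 0}\<close>. As \<open>height\<close> and the coordinate both grow at unit speed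
  along \<open>(1, \<dots>, 1)\<close>, translating along this direction exchanges them.\<close>

lemma l1_subcomplex_homeomorphic_nball:
  "top_of_set {z \<in> {z \<in> vectors (Suc m). positive_part (Suc m) z \<in> D}. l1_norm (Suc m) z = 1}
    homeomorphic_space nball m"
proof -
  \<comment> \<open>The shift in h makes the new coordinate m equal to the old height; the shift in
    k makes the new height equal to the old coordinate m.\<close>
  define h where "h = (\<lambda>z i. if i \<le> m then z i + (height z - z m) else 0)"
  define k where "k = (\<lambda>w i. if i \<le> m then w i + (w m - height w) else 0)"
  have height_h: "height (h z) = height z + (height z - z m)" for z
    using height_cong[of "h z" "\<lambda>i. z i + (height z - z m)"] by (simp add: h_def height_shift)
  have height_k: "height (k w) = w m" for w
    using height_cong[of "k w" "\<lambda>i. w i + (w m - height w)"] by (simp add: k_def height_shift)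
  have h_m: "h z m = height z" for z by (simp add: h_def)
  have k_m: "k w m = w m + (w m - height w)" for w by (simp add: k_def)
  have kh: "k (h z) = z" if "\<forall>i>m. z i = 0" for z
    using that by (auto simp: k_def height_h h_m fun_eq_iff) (auto simp: h_def)
  have hk: "h (k w) = w" if "\<forall>i>m. w i = 0" for w
    using that by (auto simp: h_def height_k k_m fun_eq_iff) (auto simp: k_def)
  \<comment> \<open>Homogeneity with factor 2 forces this value. Hence the mutually inverse h and k
    fix the origin and send no other vector to it.\<close>
  have zero: "height (\<lambda>i. 0) = 0" using height_scale[of 2 "\<lambda>i. 0"] by simp
  have h0: "h (\<lambda>i. 0) = (\<lambda>i. 0)" and k0: "k (\<lambda>i. 0) = (\<lambda>i. 0)"
    by (simp_all add: h_def k_def zero fun_eq_iff)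
  have vec: "z \<in> vectors (Suc m) \<longleftrightarrow> (\<forall>i>m. z i = 0) \<and> z \<noteq> (\<lambda>i. 0)" for z
    unfolding vectors_def fun_eq_iff Suc_le_eq less_Suc_eq_le mem_Collect_eq by (meson not_le)
  have h_vec: "h z \<in> vectors (Suc m)" if "z \<in> vectors (Suc m)" for z
    using that kh[of z] k0 unfolding vec by (auto simp: h_def)
  have k_vec: "k w \<in> vectors (Suc m)" if "w \<in> vectors (Suc m)" for w
    using that hk[of w] h0 unfolding vec by (auto simp: k_def)
  have h_scale: "h (\<lambda>i. r * z i) = (\<lambda>i. r * h z i)" if "0 < r" for r z
    using that by (simp add: h_def height_scale fun_eq_iff algebra_simps)
  have k_scale: "k (\<lambda>i. r * z i) = (\<lambda>i. r * k z i)" if "0 < r" for r z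
    using that by (simp add: k_def height_scale fun_eq_iff algebra_simps)
  have cont_h: "continuous_on A h" for A
  proof (rule continuous_on_coordinatewise_then_product)
    show "continuous_on A (\<lambda>z. h z i)" for i
      unfolding h_def
      by (cases "i \<le> m") (auto intro!: continuous_intros continuous_on_height
          continuous_on_coordinate)
  qed
  have cont_k: "continuous_on A k" for A
  proof (rule continuous_on_coordinatewise_then_product)
    show "continuous_on A (\<lambda>z. k z i)" for i
      unfolding k_def
      by (cases "i \<le> m") (auto intro!: continuous_intros continuous_on_height
          continuous_on_coordinate)
  qed
  have "top_of_set {z \<in> {z \<in> vectors (Suc m). positive_part (Suc m) z \<in> D}. l1_norm (Suc m) z = 1}
    homeomorphic_space top_of_set {w \<in> vectors (Suc m) \<inter> {w. w m \<le> 0}. l2_norm (Suc m) w = 1}"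
  proof (rule homeomorphic_space_homogeneous[where h = h and k = k])
    have face: "positive_part (Suc m) z \<in> D \<longleftrightarrow> height z \<le> 0" for z
      using height_pos_iff[of z] by auto
    show "h \<in> {z \<in> vectors (Suc m). positive_part (Suc m) z \<in> D} \<rightarrow> vectors (Suc m) \<inter> {w. w m \<le> 0}"
      by (simp add: h_vec h_m face)
    show "k \<in> vectors (Suc m) \<inter> {w. w m \<le> 0} \<rightarrow> {z \<in> vectors (Suc m). positive_part (Suc m) z \<in> D}"
      by (simp add: k_vec height_k face)
    show "k (h z) = z" if "z \<in> {z \<in> vectors (Suc m). positive_part (Suc m) z \<in> D}" for z
      using that by (simp add: kh vec)
    show "h (k w) = w" if "w \<in> vectors (Suc m) \<inter> {w. w m \<le> 0}" for w
      using that by (simp add: hk vec)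
  qed (auto simp: cont_h cont_k h_scale k_scale vectors_scale positive_part_scale l1_norm_pos
      l2_norm_pos l1_norm_scale l2_norm_scale continuous_on_l1_norm continuous_on_l2_norm
      mult_le_0_iff)
  then show ?thesis using hemisphere_homeomorphic_nball homeomorphic_space_trans by blast
qed

end

section \<open>Signed coordinates on the realization\<close>

definition realization_points :: "'v set set \<Rightarrow> ('v \<Rightarrow> real) set" where
  "realization_points \<Delta> = {t. (\<forall>v. 0 \<le> t v) \<and> {v. t v \<noteq> 0} \<in> \<Delta> \<and> (\<Sum>v | t v \<noteq> 0. t v) = 1}"

lemma geometric_realization_eq: "geometric_realization \<Delta> = top_of_set (realization_points \<Delta>)"
  by (simp add: geometric_realization_def realization_points_def powertop_real_eq_euclidean)

context coloured_complex
begin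

lemma colour_complex_sub: "X \<in> colour_complex \<Delta> s c \<Longrightarrow> X \<subseteq> Inl ` V \<union> Inr ` {1..s}"
proof
  fix p assume X: "X \<in> colour_complex \<Delta> s c" "p \<in> X"
  then have "{v. Inl v \<in> X} \<subseteq> V" using face_sub by (simp add: colour_complex_iff)
  then show "p \<in> Inl ` V \<union> Inr ` {1..s}"
    using X by (cases p) (auto simp: colour_complex_iff)
qed

text \<open>No face contains a vertex of \<Delta> together with the new vertex of its colour, so one
  of their two weights vanishes. Their difference is a signed coordinate whose positive and negative
  parts recover the weights, and the total weight becomes the l1 norm.\<close>

lemma realization_discrete:
  assumes "discrete_colouring V s c"
  obtains y where "bij_betw y {..<s} V"
    "geometric_realization (colour_complex \<Delta> s c) homeomorphic_space
      top_of_set {z \<in> {z \<in> vectors s. y ` positive_part s z \<in> \<Delta>}. l1_norm s z = 1}"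
proof -
  obtain x where x: "bij_betw x {1..s} V" and cx: "\<And>j. j \<in> {1..s} \<Longrightarrow> c j = {x j}"
    by (rule discrete_enumeration[OF assms]) blast
  \<comment> \<open>Colours count from 1 and coordinates from 0: coordinate i belongs to the old
    vertex \<open>y i\<close> and to the new vertex \<open>Inr (Suc i)\<close>.\<close>
  define y where "y = (\<lambda>i. x (Suc i))"
  have "bij_betw Suc {..<s} {1..s}"
    by (rule bij_betwI[where g = "\<lambda>j. j - 1"]) auto
  then have y: "bij_betw y {..<s} V"
    using bij_betw_trans[OF _ x] unfolding y_def comp_def by blast
  have c: "c (Suc i) = {y i}" if "i < s" for i using cx[of "Suc i"] that by (simp add: y_def)
  define y' where "y' = inv_into {..<s} y"
  have y'y: "y' (y i) = i" if "i < s" for i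
    using that bij_betw_inv_into_left[OF y] by (simp add: y'_def)
  have yy': "y (y' v) = v" "y' v < s" if "v \<in> V" for v
    using that bij_betw_inv_into_right[OF y] bij_betw_apply[OF bij_betw_inv_into[OF y]]
    by (auto simp: y'_def)
  have yV: "y i \<in> V" if "i < s" for i using that bij_betw_apply[OF y] by simp
  let ?K = "realization_points (colour_complex \<Delta> s c)"
  let ?L = "{z \<in> {z \<in> vectors s. y ` positive_part s z \<in> \<Delta>}. l1_norm s z = 1}"
  define f where "f = (\<lambda>(t :: 'a + nat \<Rightarrow> real) i. if i < s then t (Inl (y i)) - t (Inr (Suc i)) else 0)"
  define g where "g = (\<lambda>z p. case p of Inl v \<Rightarrow> if v \<in> V then max (z (y' v)) 0 else 0
      | Inr j \<Rightarrow> if j \<in> {1..s} then max (- z (j - 1)) 0 else (0::real))"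
  have sum_eq: "(\<Sum>p | t p \<noteq> 0. t p) = (\<Sum>i<s. t (Inl (y i)) + t (Inr (Suc i)))"
    if "{p. t p \<noteq> 0} \<subseteq> Inl ` V \<union> Inr ` {1..s}" for t :: "'a + nat \<Rightarrow> real"
  proof -
    have "(\<Sum>p | t p \<noteq> 0. t p) = (\<Sum>p \<in> Inl ` V \<union> Inr ` {1..s}. t p)"
      using that finite_V by (intro sum.mono_neutral_left) auto
    also have "\<dots> = (\<Sum>p \<in> Inl ` V. t p) + (\<Sum>p \<in> Inr ` {1..s}. t p)"
      using finite_V by (intro sum.union_disjoint) auto
    also have "(\<Sum>p \<in> Inl ` V. t p) = (\<Sum>v\<in>V. t (Inl v))"
      by (simp add: sum.reindex)
    also have "\<dots> = (\<Sum>i<s. t (Inl (y i)))"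
      by (rule sum.reindex_bij_betw[OF y, symmetric])
    also have "(\<Sum>p \<in> Inr ` {1..s}. t p) = (\<Sum>j\<in>{1..s}. t (Inr j))"
      by (simp add: sum.reindex)
    also have "\<dots> = (\<Sum>i<s. t (Inr (Suc i)))"
      by (simp add: sum.atLeast1_atMost_eq)
    finally show ?thesis by (simp add: sum.distrib)
  qed
  have K: "\<And>p. 0 \<le> t p" "{v. t (Inl v) \<noteq> 0} \<in> \<Delta>" "\<And>v. v \<notin> V \<Longrightarrow> t (Inl v) = 0"
    "\<And>j. j \<notin> {1..s} \<Longrightarrow> t (Inr j) = 0"
    "\<And>i. i < s \<Longrightarrow> t (Inl (y i)) = 0 \<or> t (Inr (Suc i)) = 0"
    "(\<Sum>i<s. t (Inl (y i)) + t (Inr (Suc i))) = 1"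
    if "t \<in> ?K" for t
  proof -
    have X: "{p. t p \<noteq> 0} \<in> colour_complex \<Delta> s c" and nn: "\<And>p. 0 \<le> t p"
      and one: "(\<Sum>p | t p \<noteq> 0. t p) = 1"
      using that by (auto simp: realization_points_def)
    note sub = colour_complex_sub[OF X]
    show "\<And>p. 0 \<le> t p" by (rule nn)
    show "{v. t (Inl v) \<noteq> 0} \<in> \<Delta>" using X by (simp add: colour_complex_iff)
    show "\<And>v. v \<notin> V \<Longrightarrow> t (Inl v) = 0" using sub by auto
    show "\<And>j. j \<notin> {1..s} \<Longrightarrow> t (Inr j) = 0" using sub by auto
    show "t (Inl (y i)) = 0 \<or> t (Inr (Suc i)) = 0" if "i < s" for i
      using X c[OF that] by (auto simp: colour_complex_iff)
    show "(\<Sum>i<s. t (Inl (y i)) + t (Inr (Suc i))) = 1" using one sum_eq[OF sub] by simp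
  qed
  have "top_of_set ?K homeomorphic_space top_of_set ?L"
  proof (rule homeomorphic_space_top_of_set[where f = f and g = g])
    show "continuous_on ?K f"
    proof (rule continuous_on_coordinatewise_then_product)
      show "continuous_on ?K (\<lambda>t. f t i)" for i
        unfolding f_def by (cases "i < s") (auto intro!: continuous_intros continuous_on_coordinate)
    qed
    show "continuous_on ?L g"
    proof (rule continuous_on_coordinatewise_then_product)
      fix p :: "'a + nat"
      show "continuous_on ?L (\<lambda>z. g z p)"
      proof (cases p)
        case (Inl v)
        then show ?thesis unfolding g_def
          by (cases "v \<in> V") (auto intro!: continuous_intros continuous_on_coordinate)
      next
        case (Inr j)
        then show ?thesis unfolding g_def
          by (cases "j \<in> {1..s}") (auto intro!: continuous_intros continuous_on_coordinate)
      qed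
    qed
    show "f \<in> ?K \<rightarrow> ?L"
    proof
      fix t assume t: "t \<in> ?K"
      note Kt = K[OF t]
      have abs: "\<bar>f t i\<bar> = t (Inl (y i)) + t (Inr (Suc i))" if "i < s" for i
        using Kt(5)[OF that] Kt(1)[of "Inl (y i)"] Kt(1)[of "Inr (Suc i)"] that by (auto simp: f_def)
      have norm: "l1_norm s (f t) = 1" using Kt(6) abs by (simp add: l1_norm_def)
      have "\<exists>i<s. f t i \<noteq> 0"
      proof (rule ccontr)
        assume "\<not> (\<exists>i<s. f t i \<noteq> 0)"
        then have "l1_norm s (f t) = 0" by (simp add: l1_norm_def)
        with norm show False by simp
      qed
      then have vec: "f t \<in> vectors s" unfolding vectors_def by (auto simp: f_def)
      have "y ` positive_part s (f t) \<subseteq> {v. t (Inl v) \<noteq> 0}"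
      proof
        fix v assume "v \<in> y ` positive_part s (f t)"
        then obtain i where i: "i < s" "0 < f t i" "v = y i" by (auto simp: positive_part_def)
        then show "v \<in> {v. t (Inl v) \<noteq> 0}" using Kt(1)[of "Inr (Suc i)"] by (auto simp: f_def)
      qed
      then have "y ` positive_part s (f t) \<in> \<Delta>" by (rule down[OF Kt(2)])
      with vec norm show "f t \<in> ?L" by simp
    qed
    show "g \<in> ?L \<rightarrow> ?K"
    proof
      fix z assume z: "z \<in> ?L"
      have g_l: "g z (Inl (y i)) = max (z i) 0" "g z (Inr (Suc i)) = max (- z i) 0" if "i < s" for i
        using that by (auto simp: g_def yV y'y)
      have sub: "{p. g z p \<noteq> 0} \<subseteq> Inl ` V \<union> Inr ` {1..s}"
      proof
        fix p assume "p \<in> {p. g z p \<noteq> 0}"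
        then show "p \<in> Inl ` V \<union> Inr ` {1..s}"
          by (cases p) (auto simp: g_def split: if_splits)
      qed
      have "(\<Sum>p | g z p \<noteq> 0. g z p) = (\<Sum>i<s. g z (Inl (y i)) + g z (Inr (Suc i)))"
        by (rule sum_eq[OF sub])
      also have "\<dots> = l1_norm s z"
        unfolding l1_norm_def by (intro sum.cong refl) (simp add: g_l max_def)
      finally have one: "(\<Sum>p | g z p \<noteq> 0. g z p) = 1" using z by simp
      have nn: "0 \<le> g z p" for p by (cases p) (auto simp: g_def)
      have pos: "{v. g z (Inl v) \<noteq> 0} \<subseteq> y ` positive_part s z"
      proof
        fix v assume "v \<in> {v. g z (Inl v) \<noteq> 0}"
        then have "v \<in> V" "0 < z (y' v)" by (auto simp: g_def max_def split: if_splits)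
        then show "v \<in> y ` positive_part s z"
          using yy'[of v] by (intro image_eqI[of _ _ "y' v"]) (auto simp: positive_part_def)
      qed
      have "{p. g z p \<noteq> 0} \<in> colour_complex \<Delta> s c"
        unfolding colour_complex_iff mem_Collect_eq
      proof (intro conjI allI impI)
        show "{v. g z (Inl v) \<noteq> 0} \<in> \<Delta>" using z down[OF _ pos] by simp
        fix j assume j: "g z (Inr j) \<noteq> 0"
        then show js: "j \<in> {1..s}" by (auto simp: g_def split: if_splits)
        define i where "i = j - 1"
        have i: "j = Suc i" "i < s" using js by (auto simp: i_def)
        show "\<forall>v\<in>c j. \<not> g z (Inl v) \<noteq> 0"
          using j c[OF i(2)] g_l[OF i(2)] unfolding i(1) by (auto simp: max_def split: if_splits)
      qed
      with one nn show "g z \<in> ?K" by (simp add: realization_points_def)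
    qed
    show "g (f t) = t" if t: "t \<in> ?K" for t
    proof
      note Kt = K[OF t]
      fix p
      show "g (f t) p = t p"
      proof (cases p)
        case (Inl v)
        show ?thesis
        proof (cases "v \<in> V")
          case True
          then show ?thesis
            using Inl yy'[OF True] Kt(5)[of "y' v"] Kt(1)[of p] Kt(1)[of "Inr (Suc (y' v))"]
            by (auto simp: g_def f_def)
        qed (use Inl Kt(3) in \<open>auto simp: g_def\<close>)
      next
        case (Inr j)
        show ?thesis
        proof (cases "j \<in> {1..s}")
          case True
          define i where "i = j - 1"
          have i: "j = Suc i" "i < s" using True by (auto simp: i_def)
          show ?thesis
            using Inr i Kt(5)[OF i(2)] Kt(1)[of p] Kt(1)[of "Inl (y i)"]
            by (auto simp: g_def f_def)
        qed (use Inr Kt(4) in \<open>auto simp: g_def\<close>)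
      qed
    qed
    show "f (g z) = z" if z: "z \<in> ?L" for z
    proof
      fix i show "f (g z) i = z i"
        using z by (cases "i < s") (auto simp: f_def g_def yV y'y vectors_def)
    qed
  qed
  then show thesis using that y unfolding geometric_realization_eq by blast
qed

lemma is_simplex_iff: "is_simplex \<Delta> \<longleftrightarrow> V \<in> \<Delta>"
proof
  assume "is_simplex \<Delta>"
  then obtain F where F: "facets \<Delta> = {F}" by (auto simp: is_simplex_def)
  have "V \<subseteq> F"
  proof
    fix v assume "v \<in> V"
    then obtain G where "G \<in> facets \<Delta>" "{v} \<subseteq> G" by (rule face_in_facet[OF vertex])
    then show "v \<in> F" using F by simp
  qed
  moreover have "F \<in> \<Delta>" using F unfolding facets_def by blast
  ultimately show "V \<in> \<Delta>" by (metis down)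
next
  assume V: "V \<in> \<Delta>"
  have "F \<in> facets \<Delta> \<longleftrightarrow> F = V" for F
    unfolding facets_def mem_Collect_eq using V face_sub by (metis subset_antisym)
  then have "facets \<Delta> = {V}" by blast
  then show "is_simplex \<Delta>" by (auto simp: is_simplex_def)
qed

lemma sphere_or_ball_if_discrete:
  assumes "discrete_colouring V s c"
  shows "if is_simplex \<Delta> then simplicial_sphere (colour_complex \<Delta> s c)
    else simplicial_ball (colour_complex \<Delta> s c)"
proof -
  obtain y where y: "bij_betw y {..<s} V" and hom:
    "geometric_realization (colour_complex \<Delta> s c) homeomorphic_space
      top_of_set {z \<in> {z \<in> vectors s. y ` positive_part s z \<in> \<Delta>}. l1_norm s z = 1}"
    by (rule realization_discrete[OF assms])
  obtain m where m: "s = Suc m" using s_pos by (cases s) auto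
  show ?thesis
  proof (cases "V \<in> \<Delta>")
    case True
    \<comment> \<open>With V a face no sign pattern is forbidden, so the realization is the whole l1
      sphere.\<close>
    have "y ` positive_part s z \<in> \<Delta>" for z
    proof (rule down[OF True])
      show "y ` positive_part s z \<subseteq> V" using bij_betw_apply[OF y] by (auto simp: positive_part_def)
    qed
    then have "geometric_realization (colour_complex \<Delta> s c) homeomorphic_space
        top_of_set {z \<in> vectors (Suc m). l1_norm (Suc m) z = 1}"
      using hom by (simp add: m)
    then have "geometric_realization (colour_complex \<Delta> s c) homeomorphic_space nsphere m"
      using l1_sphere_homeomorphic_nsphere by (rule homeomorphic_space_trans)
    then show ?thesis using True by (auto simp: is_simplex_iff simplicial_sphere_def)
  next
    case False
    interpret proper_subcomplex m "{I. y ` I \<in> \<Delta>}"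
    proof
      show "{..m} \<notin> {I. y ` I \<in> \<Delta>}"
        using False bij_betw_imp_surj_on[OF y] by (simp add: m lessThan_Suc_atMost)
      show "J \<in> {I. y ` I \<in> \<Delta>}" if "I \<in> {I. y ` I \<in> \<Delta>}" "J \<subseteq> I" for I J
        using that down image_mono[of J I y] by simp
    qed (simp add: empty_face)
    have "geometric_realization (colour_complex \<Delta> s c) homeomorphic_space
        top_of_set {z \<in> {z \<in> vectors (Suc m). positive_part (Suc m) z \<in> {I. y ` I \<in> \<Delta>}}.
          l1_norm (Suc m) z = 1}"
      using hom by (simp add: m)
    then have "geometric_realization (colour_complex \<Delta> s c) homeomorphic_space nball m"
      using l1_subcomplex_homeomorphic_nball by (rule homeomorphic_space_trans)
    then show ?thesis using False by (auto simp: is_simplex_iff simplicial_ball_def)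
  qed
qed

end

section \<open>Three facets at a ridge\<close>

abbreviation coord_space :: "nat \<Rightarrow> (nat \<Rightarrow> real) set" where
  "coord_space n \<equiv> {x. \<forall>i\<ge>n. x i = 0}"

lemma Euclidean_space_eq: "Euclidean_space n = top_of_set (coord_space n)"
  by (simp add: Euclidean_space_def powertop_real_eq_euclidean)

lemma open_image_coord_space:
  assumes "n \<le> m" "openin (top_of_set (coord_space m)) U" "continuous_on U f"
    "f \<in> U \<rightarrow> coord_space n" "inj_on f U"
  shows "openin (top_of_set (coord_space n)) (f ` U)"
proof -
  have "U \<subseteq> coord_space m" using assms(2) openin_imp_subset by blast
  then have "subtopology (top_of_set (coord_space m)) U = top_of_set U"
    by (simp add: subtopology_subtopology Int_absorb1)
  then have "continuous_map (subtopology (Euclidean_space m) U) (Euclidean_space n) f"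
    using assms(3,4) by (auto simp: Euclidean_space_eq)
  then show ?thesis
    using invariance_of_domain_Euclidean_space_gen[OF assms(1), of U f] assms(2,5)
    by (simp add: Euclidean_space_eq)
qed

text \<open>The path need not stay in S. Moving a point along a path tests openness in three places:
  normal to a coordinate subspace, toward the centre of a ball, and onto the third page.\<close>

lemma openin_path:
  fixes \<phi> :: "real \<Rightarrow> 'b::topological_space"
  assumes "openin (top_of_set S) W" "continuous_on UNIV \<phi>" "\<phi> a \<in> W"
  obtains e where "0 < e" "\<And>x. \<bar>x - a\<bar> < e \<Longrightarrow> \<phi> x \<in> S \<Longrightarrow> \<phi> x \<in> W"
proof -
  obtain T where T: "open T" "W = S \<inter> T" using assms(1) by (auto simp: openin_open)
  have "open (\<phi> -` T)" using T(1) assms(2) by (simp add: open_vimage)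
  moreover have "a \<in> \<phi> -` T" using assms(3) T(2) by simp
  ultimately obtain e where "0 < e" "ball a e \<subseteq> \<phi> -` T" using open_contains_ball by metis
  then show thesis using T(2) that[of e] by (auto simp: ball_def dist_real_def abs_minus_commute)
qed

text \<open>If n < m, the image would be open in the larger space by invariance of domain, yet
  coordinate n vanishes on all of it.\<close>

lemma invariance_of_dimension_le:
  assumes U: "openin (top_of_set (coord_space m)) U" "U \<noteq> {}" and f: "continuous_on U f"
    "f \<in> U \<rightarrow> coord_space n" "inj_on f U"
  shows "m \<le> n"
proof (rule ccontr)
  assume "\<not> m \<le> n"
  then have "coord_space n \<subseteq> coord_space m" by auto
  then have "f \<in> U \<rightarrow> coord_space m" using f(2) by blast
  then have op: "openin (top_of_set (coord_space m)) (f ` U)"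
    using open_image_coord_space[of m m U f] U f by blast
  obtain p where p: "p \<in> f ` U" using U(2) by blast
  then have pn: "\<forall>i\<ge>n. p i = 0" using f(2) by auto
  have "continuous_on UNIV (\<lambda>x::real. p(n := x))"
  proof (rule continuous_on_coordinatewise_then_product)
    show "continuous_on UNIV (\<lambda>x. (p(n := x)) i)" for i
      by (cases "i = n") (auto intro: continuous_intros)
  qed
  moreover have "p(n := 0) \<in> f ` U" using p pn by (simp add: fun_upd_idem)
  ultimately obtain e where e: "0 < e"
    "\<And>x. \<bar>x - 0\<bar> < e \<Longrightarrow> p(n := x) \<in> coord_space m \<Longrightarrow> p(n := x) \<in> f ` U"
    using openin_path[OF op, of "\<lambda>x. p(n := x)" 0] by blast
  have "p(n := e / 2) \<in> f ` U" using e \<open>\<not> m \<le> n\<close> pn by simp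
  then obtain u where u: "p(n := e / 2) = f u" "u \<in> U" by (rule imageE)
  have "f u \<in> coord_space n" using f(2) u(2) by (rule funcset_mem)
  then have "(p(n := e / 2)) n = 0" unfolding u(1)[symmetric] by blast
  then show False using e(1) by simp
qed

lemma continuous_on_scale: "continuous_on UNIV (\<lambda>(x::real) i. x * q i)"
  by (intro continuous_on_coordinatewise_then_product continuous_intros)

text \<open>\<open>r\<close> lists the m vertices of the ridge, so each page has dimension m. That
  the first page is a facet makes its interior open in the realization, which bounds the dimension
  of a ball from above.\<close>

locale three_pages =
  fixes X :: "'v set set" and m :: nat and r :: "nat \<Rightarrow> 'v" and p0 p1 p2 :: 'v
  assumes down: "F \<in> X \<Longrightarrow> G \<subseteq> F \<Longrightarrow> G \<in> X"
    and inj: "inj_on r {..<m}"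
    and distinct: "p0 \<noteq> p1" "p0 \<noteq> p2" "p1 \<noteq> p2"
    and notin: "p0 \<notin> r ` {..<m}" "p1 \<notin> r ` {..<m}" "p2 \<notin> r ` {..<m}"
    and page0: "insert p0 (r ` {..<m}) \<in> facets X"
    and page1: "insert p1 (r ` {..<m}) \<in> X"
    and page2: "insert p2 (r ` {..<m}) \<in> X"
begin

abbreviation "K \<equiv> realization_points X"
abbreviation "B d \<equiv> {u :: nat \<Rightarrow> real. (\<forall>i\<ge>d. u i = 0) \<and> (\<Sum>i<d. u i ^ 2) \<le> 1}"

lemma page0_face: "insert p0 (r ` {..<m}) \<in> X"
  using page0 by (simp add: facets_def)

lemma sum_page:
  assumes "{v. t v \<noteq> 0} \<subseteq> insert p (r ` {..<m})" "p \<notin> r ` {..<m}"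
  shows "(\<Sum>v | t v \<noteq> 0. t v) = t p + (\<Sum>i<m. t (r i) :: real)"
proof -
  have "(\<Sum>v | t v \<noteq> 0. t v) = (\<Sum>v \<in> insert p (r ` {..<m}). t v)"
    using assms(1) by (intro sum.mono_neutral_left) auto
  also have "\<dots> = t p + (\<Sum>v \<in> r ` {..<m}. t v)" using assms(2) by (intro sum.insert) auto
  also have "(\<Sum>v \<in> r ` {..<m}. t v) = (\<Sum>i<m. t (r i))" by (rule sum.reindex_cong[OF inj refl refl])
  finally show ?thesis .
qed

lemma page_point:
  assumes "insert p (r ` {..<m}) \<in> X" "p \<notin> r ` {..<m}" "\<And>v. 0 \<le> t v"
    "{v. t v \<noteq> 0} \<subseteq> insert p (r ` {..<m})" "t p + (\<Sum>i<m. t (r i)) = 1"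
  shows "t \<in> K"
  using assms sum_page[OF assms(4,2)] down[OF assms(1,4)] by (simp add: realization_points_def)

text \<open>By maximality of the first page, a point positive on all its vertices has exactly this
  support and is determined by its m ridge coordinates, the weights summing to 1. These points form
  an open set that embeds into m-space; transported to the ball, it bounds d.\<close>

lemma dimension_le:
  assumes hom: "homeomorphic_maps (top_of_set K) (top_of_set (B d)) f g"
  shows "d \<le> m"
proof -
  have f: "continuous_on K f" "f \<in> K \<rightarrow> B d" and g: "continuous_on (B d) g" "g \<in> B d \<rightarrow> K"
    and gf: "\<And>t. t \<in> K \<Longrightarrow> g (f t) = t" and fg: "\<And>b. b \<in> B d \<Longrightarrow> f (g b) = b"
    using hom by (auto simp: homeomorphic_maps_def)
  let ?F = "insert p0 (r ` {..<m})"
  define U where "U = {t \<in> K. \<forall>p\<in>?F. 0 < t p}"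
  have "U = K \<inter> (\<Inter>p\<in>?F. {t. 0 < t p})" by (auto simp: U_def)
  moreover have "open (\<Inter>p\<in>?F. {t. (0::real) < t p})"
    by (intro open_INT ballI open_Collect_less continuous_intros continuous_on_coordinate) auto
  ultimately have openU: "openin (top_of_set K) U" by (auto simp: openin_open)
  have supp: "{v. t v \<noteq> 0} = ?F" if "t \<in> U" for t
  proof -
    have "{v. t v \<noteq> 0} \<in> X" using that by (simp add: U_def realization_points_def)
    have pos: "\<forall>p\<in>?F. 0 < t p" using that unfolding U_def by blast
    have "?F \<subseteq> {v. t v \<noteq> 0}"
    proof
      fix v assume "v \<in> ?F"
      with pos have "0 < t v" by (rule bspec)
      then show "v \<in> {v. t v \<noteq> 0}" by simp
    qed
    with \<open>{v. t v \<noteq> 0} \<in> X\<close> show ?thesis using page0 unfolding facets_def by blast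
  qed
  have total: "t p0 + (\<Sum>i<m. t (r i)) = 1" if "t \<in> U" for t
  proof -
    have "(\<Sum>v | t v \<noteq> 0. t v) = 1" using that unfolding U_def realization_points_def by blast
    moreover have "(\<Sum>v | t v \<noteq> 0. t v) = t p0 + (\<Sum>i<m. t (r i))"
      by (rule sum_page[OF _ notin(1)]) (use supp[OF that] in blast)
    ultimately show ?thesis by simp
  qed
  define \<psi> where "\<psi> = (\<lambda>(t :: 'v \<Rightarrow> real) i. if i < m then t (r i) else 0)"
  have cont_\<psi>: "continuous_on U \<psi>"
  proof (rule continuous_on_coordinatewise_then_product)
    show "continuous_on U (\<lambda>t. \<psi> t i)" for i
      unfolding \<psi>_def by (cases "i < m") (auto intro: continuous_on_coordinate)
  qed
  have inj_\<psi>: "inj_on \<psi> U"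
  proof (rule inj_onI)
    fix t t' assume t: "t \<in> U" "t' \<in> U" "\<psi> t = \<psi> t'"
    have r: "t (r i) = t' (r i)" if "i < m" for i using fun_cong[OF t(3), of i] that by (simp add: \<psi>_def)
    have "t p0 + (\<Sum>i<m. t (r i)) = 1" "t' p0 + (\<Sum>i<m. t' (r i)) = 1"
      using total t(1,2) by blast+
    moreover have "(\<Sum>i<m. t (r i)) = (\<Sum>i<m. t' (r i))" using r by (intro sum.cong) auto
    ultimately have p0: "t p0 = t' p0" by linarith
    show "t = t'"
    proof
      fix v show "t v = t' v"
      proof (cases "v \<in> ?F")
        case False
        then have "v \<notin> {v. t v \<noteq> 0}" "v \<notin> {v. t' v \<noteq> 0}"
          using supp[OF t(1)] supp[OF t(2)] by simp_all
        then show ?thesis by simp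
      qed (use r p0 in auto)
    qed
  qed
  define W where "W = {b \<in> B d. g b \<in> U}"
  have openW: "openin (top_of_set (B d)) W"
    using g openU continuous_openin_preimage[of "B d" g K U] by (simp add: W_def vimage_def Int_def)
  \<comment> \<open>A relatively open subset of the closed ball need not be open in d-space, so the
    boundary sphere is cut away.\<close>
  define W' where "W' = W \<inter> {b. (\<Sum>i<d. b i ^ 2) < 1}"
  have "openin (top_of_set (coord_space d)) W'"
  proof -
    obtain T where T: "open T" "W = B d \<inter> T" using openW by (auto simp: openin_open)
    have "open {b :: nat \<Rightarrow> real. (\<Sum>i<d. b i ^ 2) < 1}"
      by (intro open_Collect_less continuous_intros continuous_on_coordinate)
    then have "open (T \<inter> {b. (\<Sum>i<d. b i ^ 2) < 1})" using T(1) by auto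
    moreover have "W' = coord_space d \<inter> (T \<inter> {b. (\<Sum>i<d. b i ^ 2) < 1})"
      by (auto simp: W'_def T(2))
    ultimately show ?thesis by (auto simp: openin_open)
  qed
  moreover have "W' \<noteq> {}"
  proof -
    define t0 where "t0 = (\<lambda>v. if v \<in> ?F then 1 / real (Suc m) else 0)"
    have "t0 \<in> K"
    proof (rule page_point[OF page0_face notin(1)])
      show "t0 p0 + (\<Sum>i<m. t0 (r i)) = 1" by (simp add: t0_def field_simps)
    qed (auto simp: t0_def)
    then have t0: "t0 \<in> U" by (simp add: U_def t0_def)
    define q where "q = f t0"
    have q: "q \<in> B d" "q \<in> W" using \<open>t0 \<in> K\<close> f(2) gf t0 by (auto simp: W_def q_def)
    have "(\<lambda>i. 1 * q i) \<in> W" using q by simp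
    then obtain e where e: "0 < e"
      "\<And>x. \<bar>x - 1\<bar> < e \<Longrightarrow> (\<lambda>i. x * q i) \<in> B d \<Longrightarrow> (\<lambda>i. x * q i) \<in> W"
      using openin_path[OF openW continuous_on_scale, of 1 q] by blast
    \<comment> \<open>The image q of the barycentre of the page may lie on the boundary sphere.
      Shrinking it slightly toward the centre stays in W and reaches the interior; the bound 1/2
      keeps the factor positive.\<close>
    define x where "x = 1 - min (e / 2) (1 / 2)"
    have x: "0 < x" "x < 1" "\<bar>x - 1\<bar> < e" using e(1) by (auto simp: x_def min_def)
    have "(\<Sum>i<d. (x * q i) ^ 2) = x ^ 2 * (\<Sum>i<d. q i ^ 2)"
      by (simp add: power_mult_distrib sum_distrib_left)
    also have "\<dots> \<le> x ^ 2 * 1" using q by (intro mult_left_mono) auto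
    also have "\<dots> < 1" using x by (simp add: power_less_one_iff)
    finally have lt: "(\<Sum>i<d. (x * q i) ^ 2) < 1" .
    then have "(\<lambda>i. x * q i) \<in> B d" using q by simp
    then have "(\<lambda>i. x * q i) \<in> W'" using e(2) x lt by (simp add: W'_def)
    then show ?thesis by blast
  qed
  moreover have "continuous_on W' (\<lambda>b. \<psi> (g b))"
    by (rule continuous_on_compose2[OF cont_\<psi>])
      (auto simp: W'_def W_def intro: continuous_on_subset[OF g(1)])
  moreover have "(\<lambda>b. \<psi> (g b)) \<in> W' \<rightarrow> coord_space m" by (simp add: \<psi>_def)
  moreover have "inj_on (\<lambda>b. \<psi> (g b)) W'"
  proof (rule inj_onI)
    fix b b' assume b: "b \<in> W'" "b' \<in> W'" "\<psi> (g b) = \<psi> (g b')"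
    then have "g b = g b'" using inj_onD[OF inj_\<psi>] by (simp add: W'_def W_def)
    then show "b = b'" using b fg by (metis (no_types, lifting) IntD1 W'_def W_def mem_Collect_eq)
  qed
  ultimately show ?thesis by (rule invariance_of_dimension_le)
qed

text \<open>A chart across the ridge: the sign of \<open>u 0\<close> selects the page and its
  absolute value is the weight off the ridge. The other parameters are the weights of
  \<open>r 1\<close>, ..., \<open>r (m - 1)\<close>, and \<open>r 0\<close> receives the rest so
  that the weights sum to 1.\<close>

definition two_pages :: "(nat \<Rightarrow> real) \<Rightarrow> 'v \<Rightarrow> real" where
  "two_pages u v = (if v = p0 then max (u 0) 0 else if v = p1 then max (- u 0) 0
     else if v \<in> r ` {..<m} then
       (if v = r 0 then 1 - \<bar>u 0\<bar> - (\<Sum>k\<in>{1..<m}. u k) else u (inv_into {..<m} r v))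
     else 0)"

text \<open>All ridge weights are positive here, the last inequality being the one for
  \<open>r 0\<close>, while \<open>u 0\<close> may have either sign. Strict inequalities make the
  set open in m-space.\<close>

definition two_pages_domain :: "(nat \<Rightarrow> real) set" where
  "two_pages_domain = {u \<in> coord_space m. (\<forall>k\<in>{1..<m}. 0 < u k) \<and> \<bar>u 0\<bar> + (\<Sum>k\<in>{1..<m}. u k) < 1}"

text \<open>The chart across two pages gives the dimension bound opposite to
  \<open>dimension_le\<close>, so d = m. Its image in the ball is then open in the surrounding
  space, and the preimage of this image under f is a neighbourhood of a ridge point.\<close>

lemma not_ball:
  assumes hom: "homeomorphic_maps (top_of_set K) (top_of_set (B d)) f g"
  shows False
proof -
  have f: "continuous_on K f" "f \<in> K \<rightarrow> B d" and gf: "\<And>t. t \<in> K \<Longrightarrow> g (f t) = t"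
    using hom by (auto simp: homeomorphic_maps_def)
  have inj_f: "inj_on f K" by (rule inj_on_inverseI[of K g f]) (rule gf)
  have dm: "d \<le> m" using hom by (rule dimension_le)
  \<comment> \<open>A path into the third page: weight x at \<open>p2\<close>, the rest spread
    evenly over the ridge, starting at the barycentre of the ridge.\<close>
  define \<tau> where "\<tau> = (\<lambda>x v. if v = p2 then x else if v \<in> r ` {..<m} then (1 - x) / real m else 0)"
  show False
  proof (cases "m = 0")
    \<comment> \<open>Without ridge vertices no barycentre of the ridge exists. Here d = 0, so the
      ball is a point, but \<open>p0\<close> and \<open>p1\<close> are distinct points of the
      realization.\<close>
    case True
    have "(\<lambda>v. if v = p then 1 else 0) \<in> K" if "insert p (r ` {..<m}) \<in> X" for p
      using that True by (intro page_point[of p]) auto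
    then have K: "(\<lambda>v. if v = p0 then 1 else 0) \<in> K" "(\<lambda>v. if v = p1 then 1 else 0) \<in> K"
      using page0_face page1 by blast+
    have "f t = (\<lambda>i. 0)" if "t \<in> K" for t using f(2) that True dm by auto
    then have "(\<lambda>v. if v = p0 then 1 else 0) = (\<lambda>v. if v = p1 then 1 else (0::real))"
      using K by (intro inj_onD[OF inj_f]) auto
    then show False using distinct(1) by (metis zero_neq_one)
  next
    case False
    then have m: "0 < m" by simp
    let ?\<phi> = two_pages and ?U = two_pages_domain
    have r_eq: "r i = r k \<longleftrightarrow> i = k" if "i < m" "k < m" for i k
      using inj that by (auto dest: inj_onD)
    have \<phi>0: "?\<phi> u (r 0) = 1 - \<bar>u 0\<bar> - (\<Sum>k\<in>{1..<m}. u k)" for u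
      using m notin by (auto simp: two_pages_def)
    have \<phi>k: "?\<phi> u (r k) = u k" if "k \<in> {1..<m}" for u k
    proof -
      have "r k \<noteq> r 0" "r k \<noteq> p0" "r k \<noteq> p1" "r k \<in> r ` {..<m}" "inv_into {..<m} r (r k) = k"
        using that notin inj r_eq[of k 0] by auto
      then show ?thesis by (simp add: two_pages_def)
    qed
    have \<phi>p: "?\<phi> u p0 = max (u 0) 0" "?\<phi> u p1 = max (- u 0) 0" for u
      using distinct by (auto simp: two_pages_def)
    have sum_split: "(\<Sum>i<m. h i) = h 0 + (\<Sum>k\<in>{1..<m}. h k)" for h :: "nat \<Rightarrow> real"
    proof -
      have "{..<m} = insert 0 {1..<m}" using m by auto
      then show ?thesis by simp
    qed
    have sum_\<phi>: "(\<Sum>i<m. ?\<phi> u (r i)) = 1 - \<bar>u 0\<bar>" for u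
    proof -
      have "(\<Sum>k\<in>{1..<m}. ?\<phi> u (r k)) = (\<Sum>k\<in>{1..<m}. u k)" using \<phi>k by (intro sum.cong) auto
      then show ?thesis by (simp add: sum_split \<phi>0)
    qed
    have \<phi>K: "?\<phi> \<in> ?U \<rightarrow> K"
    proof
      fix u assume u: "u \<in> ?U"
      have nnr: "0 \<le> ?\<phi> u (r i)" if "i < m" for i
      proof (cases "i = 0")
        case True
        then show ?thesis using u by (simp add: \<phi>0 two_pages_domain_def)
      next
        case False
        then have "i \<in> {1..<m}" using that by simp
        moreover from this have "0 < u i" using u unfolding two_pages_domain_def by blast
        ultimately show ?thesis by (simp add: \<phi>k)
      qed
      have nn: "0 \<le> ?\<phi> u v" for v
      proof (cases "v \<in> r ` {..<m}")
        case True
        then show ?thesis using nnr by blast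
      next
        case False
        then show ?thesis by (simp add: two_pages_def)
      qed
      show "?\<phi> u \<in> K"
      proof (cases "0 \<le> u 0")
        case True
        show ?thesis
        proof (rule page_point[OF page0_face notin(1) nn])
          show "{v. ?\<phi> u v \<noteq> 0} \<subseteq> insert p0 (r ` {..<m})" using True by (auto simp: two_pages_def split: if_splits)
          show "?\<phi> u p0 + (\<Sum>i<m. ?\<phi> u (r i)) = 1" using True by (simp add: sum_\<phi> \<phi>p)
        qed
      next
        case False
        show ?thesis
        proof (rule page_point[OF page1 notin(2) nn])
          show "{v. ?\<phi> u v \<noteq> 0} \<subseteq> insert p1 (r ` {..<m})" using False by (auto simp: two_pages_def split: if_splits)
          show "?\<phi> u p1 + (\<Sum>i<m. ?\<phi> u (r i)) = 1" using False by (simp add: sum_\<phi> \<phi>p)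
        qed
      qed
    qed
    have inj_\<phi>: "inj_on ?\<phi> ?U"
    proof (rule inj_onI)
      fix u u' assume u: "u \<in> ?U" "u' \<in> ?U" "?\<phi> u = ?\<phi> u'"
      have "max (u 0) 0 = max (u' 0) 0" "max (- u 0) 0 = max (- u' 0) 0"
        using u(3) by (metis \<phi>p(1), metis \<phi>p(2))
      then have z: "u 0 = u' 0" by (auto simp: max_def split: if_splits)
      show "u = u'"
      proof
        fix i
        consider "i = 0" | "i \<in> {1..<m}" | "m \<le> i" by force
        then show "u i = u' i"
        proof cases
          case 2
          then show ?thesis using u(3) \<phi>k by metis
        qed (use z u in \<open>auto simp: two_pages_domain_def\<close>)
      qed
    qed
    have cont_\<phi>: "continuous_on ?U ?\<phi>"
    proof (rule continuous_on_coordinatewise_then_product)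
      fix v
      consider "v = p0" | "v = p1" | "v = r 0" | k where "k \<in> {1..<m}" "v = r k"
        | "v \<notin> insert p0 (insert p1 (r ` {..<m}))"
        by (metis Suc_leI atLeastLessThan_iff image_iff insert_iff lessThan_iff not_gr_zero One_nat_def)
      then show "continuous_on ?U (\<lambda>u. ?\<phi> u v)"
      proof cases
        case 5
        then show ?thesis by (simp add: two_pages_def)
      qed (auto simp: \<phi>0 \<phi>k \<phi>p intro!: continuous_intros continuous_on_coordinate)
    qed
    have openU: "openin (top_of_set (coord_space m)) ?U"
    proof -
      have "open ((\<Inter>k\<in>{1..<m}. {u. 0 < u k}) \<inter> {u. \<bar>u 0\<bar> + (\<Sum>k\<in>{1..<m}. u k) < (1::real)})"
        by (intro open_Int open_INT ballI open_Collect_less continuous_intros continuous_on_coordinate) auto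
      moreover have "?U = coord_space m \<inter> ((\<Inter>k\<in>{1..<m}. {u. 0 < u k}) \<inter>
          {u. \<bar>u 0\<bar> + (\<Sum>k\<in>{1..<m}. u k) < 1})"
        by (auto simp: two_pages_domain_def)
      ultimately show ?thesis unfolding openin_open by blast
    qed
    \<comment> \<open>These are the parameters of the barycentre of the ridge: the m - 1 given
      weights 1/m leave 1/m for \<open>r 0\<close>.\<close>
    define u0 where "u0 = (\<lambda>k. if k \<in> {1..<m} then 1 / real m else 0)"
    have sum_u0: "(\<Sum>k\<in>{1..<m}. u0 k) = 1 - 1 / real m"
      using m by (simp add: u0_def field_simps of_nat_diff)
    have u0: "u0 \<in> ?U" using m sum_u0 by (auto simp: two_pages_domain_def u0_def)
    have \<tau>0: "\<tau> 0 = ?\<phi> u0"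
    proof
      fix v
      consider "v = p0" | "v = p1" | "v = r 0" | k where "k \<in> {1..<m}" "v = r k"
        | "v \<notin> insert p0 (insert p1 (r ` {..<m}))"
        by (metis Suc_leI atLeastLessThan_iff image_iff insert_iff lessThan_iff not_gr_zero One_nat_def)
      then show "\<tau> 0 v = ?\<phi> u0 v"
      proof cases
        case 3
        then show ?thesis using m notin(3) sum_u0 by (auto simp: \<phi>0 \<tau>_def) (auto simp: u0_def)
      next
        case (4 k)
        then show ?thesis using notin(3) by (auto simp: \<phi>k \<tau>_def u0_def)
      qed (use notin distinct in \<open>auto simp: \<tau>_def \<phi>p u0_def two_pages_def\<close>)
    qed
    have \<tau>K: "\<tau> x \<in> K" if "0 \<le> x" "x \<le> 1" for x
    proof (rule page_point[OF page2 notin(3)])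
      have "\<tau> x (r i) = (1 - x) / real m" if "i < m" for i
        using that notin(3) by (auto simp: \<tau>_def)
      then have "(\<Sum>i<m. \<tau> x (r i)) = 1 - x" using m by simp
      then show "\<tau> x p2 + (\<Sum>i<m. \<tau> x (r i)) = 1" by (simp add: \<tau>_def)
    qed (use that in \<open>auto simp: \<tau>_def\<close>)
    have cont_\<tau>: "continuous_on UNIV \<tau>"
    proof (rule continuous_on_coordinatewise_then_product)
      show "continuous_on UNIV (\<lambda>x. \<tau> x v)" for v
        unfolding \<tau>_def by (cases "v = p2"; cases "v \<in> r ` {..<m}") (auto intro!: continuous_intros simp: m)
    qed
    have cont_f\<phi>: "continuous_on ?U (\<lambda>u. f (?\<phi> u))"
      using \<phi>K by (intro continuous_on_compose2[OF f(1) cont_\<phi>]) auto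
    have f\<phi>B: "f (?\<phi> u) \<in> B d" if "u \<in> ?U" for u using that \<phi>K f(2) by blast
    have inj_f\<phi>: "inj_on (\<lambda>u. f (?\<phi> u)) ?U"
      using comp_inj_on[OF inj_\<phi> inj_on_subset[OF inj_f]] \<phi>K by (auto simp: comp_def)
    have "m \<le> d"
      using invariance_of_dimension_le[OF openU _ cont_f\<phi> _ inj_f\<phi>] u0 f\<phi>B by blast
    with dm have d: "d = m" by simp
    have "openin (top_of_set (coord_space m)) ((\<lambda>u. f (?\<phi> u)) ` ?U)"
      using open_image_coord_space[OF order_refl openU cont_f\<phi> _ inj_f\<phi>] f\<phi>B d by blast
    then have "openin (top_of_set K) (K \<inter> f -` ((\<lambda>u. f (?\<phi> u)) ` ?U))"
      using f d by (intro continuous_openin_preimage[of K f "coord_space m"]) auto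
    moreover have "\<tau> 0 \<in> K \<inter> f -` ((\<lambda>u. f (?\<phi> u)) ` ?U)" 
      using u0 funcset_mem[OF \<phi>K u0] by (simp add: \<tau>0)
    ultimately obtain e where e: "0 < e"
      "\<And>x. \<bar>x - 0\<bar> < e \<Longrightarrow> \<tau> x \<in> K \<Longrightarrow> \<tau> x \<in> K \<inter> f -` ((\<lambda>u. f (?\<phi> u)) ` ?U)"
      using openin_path[OF _ cont_\<tau>, of K _ 0] by blast
    \<comment> \<open>The half of e keeps the point in the neighbourhood, the bound 1 keeps the
      ridge weights nonnegative. The weight x at \<open>p2\<close> is positive, whereas the chart is
      zero there.\<close>
    define x where "x = min (e / 2) 1"
    have x: "0 < x" "x \<le> 1" "\<bar>x - 0\<bar> < e" using e(1) by (auto simp: x_def min_def)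
    then obtain u where u: "u \<in> ?U" "f (\<tau> x) = f (?\<phi> u)" using e(2)[of x] \<tau>K[of x] by auto
    then have "\<tau> x = ?\<phi> u" using \<phi>K \<tau>K[of x] x by (intro inj_onD[OF inj_f]) auto
    then have "\<tau> x p2 = ?\<phi> u p2" by simp
    then show False using x notin(3) distinct by (simp add: \<tau>_def two_pages_def)
  qed
qed

end

lemma three_pages_not_ball:
  assumes "three_pages X m r p0 p1 p2"
  shows "\<not> simplicial_ball X"
  using three_pages.not_ball[OF assms]
  unfolding simplicial_ball_def geometric_realization_eq nball_eq homeomorphic_space_def by blast

context coloured_complex
begin

text \<open>The ridge consists of the s - 1 new vertices other than \<open>y\<^sub>j\<close>; the
  page required to be a facet is the one over the empty face.\<close>

lemma not_ball_if_large_class: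
  assumes j: "j \<in> {1..s}" and ab: "a \<in> c j" "b \<in> c j" "a \<noteq> b"
  shows "\<not> simplicial_ball (colour_complex \<Delta> s c)"
proof -
  have "card ({1..s} - {j}) = s - 1" using j by simp
  then obtain r where r: "bij_betw r {..<s - 1} ({1..s} - {j})"
    using ex_bij_betw_nat_finite[of "{1..s} - {j}"] by (auto simp: atLeast0LessThan)
  have im: "(\<lambda>i. Inr (r i)) ` {..<s - 1} = (Inr ` ({1..s} - {j}) :: ('a + nat) set)"
    using bij_betw_imp_surj_on[OF r] by (metis image_image)
  have abV: "a \<in> V" "b \<in> V" using class_sub[OF j] ab by auto
  have "three_pages (colour_complex \<Delta> s c) (s - 1) (\<lambda>i. Inr (r i)) (Inr j) (Inl a) (Inl b)"
  proof
    show "G \<in> colour_complex \<Delta> s c" if "F \<in> colour_complex \<Delta> s c" "G \<subseteq> F" for F G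
    proof -
      have "{v. Inl v \<in> G} \<subseteq> {v. Inl v \<in> F}" using that(2) by blast
      moreover have "{v. Inl v \<in> F} \<in> \<Delta>" using that(1) by (simp add: colour_complex_iff)
      ultimately have "{v. Inl v \<in> G} \<in> \<Delta>" by (rule down[rotated])
      then show ?thesis using that by (auto simp: colour_complex_iff)
    qed
    show "inj_on (\<lambda>i. Inr (r i) :: 'a + nat) {..<s - 1}"
      using bij_betw_imp_inj_on[OF r] by (auto simp: inj_on_def)
    show "insert (Inr j) ((\<lambda>i. Inr (r i)) ` {..<s - 1}) \<in> facets (colour_complex \<Delta> s c)"
      unfolding im facet_over_pages(1)[OF j ab(1), symmetric] facets_colour_complex
      using empty_face by (rule imageI)
    show "insert (Inl a) ((\<lambda>i. Inr (r i)) ` {..<s - 1}) \<in> colour_complex \<Delta> s c"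
      unfolding im facet_over_pages(2)[OF j ab(1), symmetric]
      by (intro facet_over_face vertex abV)
    show "insert (Inl b) ((\<lambda>i. Inr (r i)) ` {..<s - 1}) \<in> colour_complex \<Delta> s c"
      unfolding im facet_over_pages(2)[OF j ab(2), symmetric]
      by (intro facet_over_face vertex abV)
  qed (use ab im in auto)
  then show ?thesis by (rule three_pages_not_ball)
qed

text \<open>In a simplex V would be a face with two vertices of one colour. Hence only the ball
  alternative of the last condition has to be refuted.\<close>

lemma not_simplex_if_large_class:
  assumes "j \<in> {1..s}" "a \<in> c j" "b \<in> c j" "a \<noteq> b"
  shows "\<not> is_simplex \<Delta>"
  using assms class_unique[of V a b j] class_sub[OF assms(1)] by (auto simp: is_simplex_iff)

end

section \<open>The equivalences\<close>

theorem theorem4p6: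
  fixes V :: "'a set" and \<Delta> :: "'a set set" and s :: nat and c :: "nat \<Rightarrow> 'a set"
  assumes "complex_on V \<Delta>" and "V \<noteq> {}"
    and "colouring V \<Delta> s c"
    and "\<not> padded_discrete_colouring V s c"
  shows
    "(pseudomanifold (colour_complex \<Delta> s c) \<longleftrightarrow> discrete_colouring V s c) \<and>
     (discrete_colouring V s c \<longleftrightarrow> (\<exists>\<Gamma>. whiskered \<Gamma> \<and> colour_complex \<Delta> s c = Ind \<Gamma>)) \<and>
     ((\<exists>\<Gamma>. whiskered \<Gamma> \<and> colour_complex \<Delta> s c = Ind \<Gamma>) \<longleftrightarrow> (\<exists>\<Gamma>. grafted \<Gamma> \<and> colour_complex \<Delta> s c = Ind \<Gamma>)) \<and>
     ((\<exists>\<Gamma>. grafted \<Gamma> \<and> colour_complex \<Delta> s c = Ind \<Gamma>) \<longleftrightarrow>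
       (if is_simplex \<Delta> then simplicial_sphere (colour_complex \<Delta> s c)
        else simplicial_ball (colour_complex \<Delta> s c)))"
proof -
  interpret coloured_complex V \<Delta> s c
    using assms(1-3) by unfold_locales
  from assms(4) show ?thesis
  proof (cases rule: discrete_or_large_class)
    case 1
    obtain x where "\<And>j. j \<in> {1..s} \<Longrightarrow> c j = {x j}" by (rule discrete_enumeration[OF 1]) blast
    then have "pseudomanifold (colour_complex \<Delta> s c)" by (intro pseudomanifold_if_singletons) blast
    moreover obtain \<Gamma> where "whiskered \<Gamma>" "colour_complex \<Delta> s c = Ind \<Gamma>"
      using whiskered_if_discrete[OF 1] by blast
    moreover from this have "grafted \<Gamma>" by (simp add: whiskered_def)
    ultimately show ?thesis using 1 sphere_or_ball_if_discrete[OF 1] by blast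
  next
    case (2 j a b)
    have nd: "\<not> discrete_colouring V s c"
    proof
      assume "discrete_colouring V s c"
      then obtain x where "\<And>j. j \<in> {1..s} \<Longrightarrow> c j = {x j}" by (rule discrete_enumeration) blast
      then show False using 2 by (metis singletonD)
    qed
    have ng: "\<not> (\<exists>\<Gamma>. grafted \<Gamma> \<and> colour_complex \<Delta> s c = Ind \<Gamma>)"
      using class_trivial_if_grafted[OF _ _ 2(1-3)] 2(4) by blast
    have nw: "\<not> (\<exists>\<Gamma>. whiskered \<Gamma> \<and> colour_complex \<Delta> s c = Ind \<Gamma>)"
      using ng unfolding whiskered_def by blast
    show ?thesis
      by (simp only: nd ng nw not_pseudomanifold[OF 2] not_simplex_if_large_class[OF 2]
          not_ball_if_large_class[OF 2] if_False simp_thms)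
  qed
qed

end
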